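(* Let $n\ge1$ and let $G=GL(n,\mathbb C)$ (with $\mathfrak g=M_n(\mathbb C)$ and $\{e_\alpha\}$ a $\mathbb C$-basis of $\mathfrak g$) or $G=U(n)$ (with $\mathfrak g=\mathfrak u(n)$ and $\{e_\alpha\}$ an $\mathbb R$-basis of $\mathfrak g$), in the defining representation, so that the matrix size is $N=n$ and $g_{\alpha\beta}=\operatorname{Tr}(e_\alpha e_\beta)$ is computed in the defining representation. Let $\lambda\in\mathbb C\setminus\{0\}$, $\beta=\frac1{2\lambda}$ and $\Delta_n=\frac{n^2}4+2$. Let $C_1,\dots,C_m$ be an oriented link in general position with double points $x_1,\dots,x_k$, let $i\in\{1,\dots,k\}$ and $S\subset\{1,\dots,k\}\setminus\{i\}$. With $W_S$, $D_j$, $\epsilon_j$ as defined in the context, put $Q=\prod_{j\neq i}e^{\beta D_j}$, and let $D_i^{+}$ (resp. $D_i^-$) denote the operator $D_i$ when the crossing $x_i$ is an overcrossing (resp. undercrossing), i.e. with $\epsilon_i=+1$ (resp. $\epsilon_i=-1$). Write $\langle{+}\rangle=e^{\beta D_i^+}QW_S$ and $\langle{-}\rangle=e^{\beta D_i^-}QW_S$. Then $$e^{-\beta\frac n2}\langle{+}\rangle=\Big(\cosh(\beta\sqrt{\Delta_n})-\tfrac{n}{2\sqrt{\Delta_n}}\sinh(\beta\sqrt{\Delta_n})\Big)QW_S+\tfrac{2}{\sqrt{\Delta_n}}\sinh(\beta\sqrt{\Delta_n})\,QW_{S\cup\{i\}},$$ $$e^{\beta\frac n2}\langle{-}\rangle=\Big(\cosh(\beta\sqrt{\Delta_n})+\tfrac{n}{2\sqrt{\Delta_n}}\sinh(\beta\sqrt{\Delta_n})\Big)QW_S-\tfrac{2}{\sqrt{\Delta_n}}\sinh(\beta\sqrt{\Delta_n})\,QW_{S\cup\{i\}},$$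 and consequently, whenever $\cosh(\beta\sqrt{\Delta_n})\ne0$, the HOMFLY-type skein relation $$\Big(1+\tfrac{n}{2\sqrt{\Delta_n}}\tanh(\beta\sqrt{\Delta_n})\Big)e^{-\beta\frac n2}\langle{+}\rangle-\Big(1-\tfrac{n}{2\sqrt{\Delta_n}}\tanh(\beta\sqrt{\Delta_n})\Big)e^{\beta\frac n2}\langle{-}\rangle=\tfrac{4}{\sqrt{\Delta_n}}\sinh(\beta\sqrt{\Delta_n})\;QW_{S\cup\{i\}}$$ holds.
   Context: Link in general position. $C_1,\dots,C_m$ are pairwise disjoint oriented smooth simple closed curves in $\mathbb R^3=\mathbb R^2\times\mathbb R$ whose projections to $\mathbb R^2$ are immersed curves whose only multiple points are finitely many transverse double points $x_1,\dots,x_k$. Over $x_i$ lie two points $p_i^{+}=(x_i,t_i^{+})$ and $p_i^-=(x_i,t_i^-)$ of the link, labelled so that (projected tangent of the strand through $p_i^+$, projected tangent of the strand through $p_i^-$) is a positively oriented basis of $\mathbb R^2$. Put $\epsilon_i=\operatorname{sgn}(t_i^+-t_i^-)$; the crossing is an overcrossing if $\epsilon_i=+1$ and an undercrossing if $\epsilon_i=-1$. Changing the crossing at $x_i$ replaces $\epsilon_i$ by $-\epsilon_i$ and leaves the arcs and matrix variables below unchanged. Arcs. Removing the $2k$ points $p_i^\pm$ cuts the link into oriented arcs (a component containing none of these points counts as one closed arc). For each removed point $p$ let $\mathrm{in}(p)$ be the arc ending at $p$ and $\mathrm{out}(p)$ the arc starting at $p$ (possibly equal). To each arc $a$ assign an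 independent $N\times N$ complex matrix variable $h_a$, and let $\mathcal P$ be the algebra of complex polynomial functions on $\prod_a M_N(\mathbb C)$. A background connection $A$ (pulled back from the plane) enters by evaluating $h_a$ at the holonomy of $A$ along $a$; holonomies are multiplied left to right in order of traversal. Reconnected Wilson loop functions. For $S\subset\{1,\dots,k\}$, follow $\mathrm{in}(p_j^\pm)$ by $\mathrm{out}(p_j^\pm)$ if $j\notin S$, and by $\mathrm{out}(p_j^\mp)$ if $j\in S$ (oriented smoothing with a jump). This partitions the arcs into closed cyclic sequences $(a_1,\dots,a_r)$, and $W_S\in\mathcal P$ is the product over these sequences of $\operatorname{tr}(h_{a_1}\cdots h_{a_r})$. Thus $W_\emptyset=W_{C_1}\cdots W_{C_m}$, where $W_C(A)=\operatorname{tr}\operatorname{hol}_C(A)$. Operators. Let $\{e_\alpha\}$ be a basis of $\mathfrak g\subset M_N(\mathbb C)$ and $g_{\alpha\beta}=\operatorname{Tr}(e_\alpha e_\beta)$. For a removed point $p$, $\frac{\delta}{\delta A_\alpha(p)}$ is the derivation of $\mathcal P$ with $h_{\mathrm{in}(p)}\mapsto\frac12 h_{\mathrm{in}(p)}e_\alpha$, $h_{\mathrm{out}(p)}\mapsto\frac12 e_\alpha h_{\mathrm{out}(p)}$ (the sum of both if $\mathrm{in}(p)=\mathrm{out}(p)$), and all other $h_a\mapsto0$. Then $$D_i=2\,\epsilon_i\sum_{\alpha,\beta}(g^{-1})_{\alpha\beta}\frac{\delta}{\delta A_\alpha(p_i^+)}\frac{\delta}{\delta A_\beta(p_i^-)}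 .$$ The $D_i$ commute and preserve polynomial degree, so $e^{\beta D_i}$ is well defined on $\mathcal P$. The expectation of the product of Wilson loops is $\langle W_{C_1}\cdots W_{C_m}\rangle=\prod_{i=1}^k e^{\frac1{2\lambda}D_i}\,W_\emptyset$. *)

theory Defs
  imports "HOL-Analysis.Analysis" "HOL-Combinatorics.Orbits"
begin

section \<open>Oriented links in general position\<close>

text \<open>Components are numbered 1, ..., m and double points 1, ..., k. Each component is an oriented
  closed curve given by a parametrization of period 1.\<close>

record link =
  num_components :: nat
  curve :: "nat \<Rightarrow> real \<Rightarrow> (real^2) \<times> real"
  num_crossings :: nat
  double_point :: "nat \<Rightarrow> real^2"

definition smooth_curve :: "(real \<Rightarrow> 'a::real_normed_vector) \<Rightarrow> bool" where
  "smooth_curve \<gamma> \<longleftrightarrow>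
     (\<exists>D :: nat \<Rightarrow> real \<Rightarrow> 'a. D 0 = \<gamma> \<and>
        (\<forall>r t. (D r has_vector_derivative D (Suc r) t) (at t)))"

definition link_set :: "link \<Rightarrow> ((real^2) \<times> real) set" where
  "link_set L = (\<Union>c\<in>{1..num_components L}. range (curve L c))"

definition projected_velocity :: "link \<Rightarrow> nat \<Rightarrow> real \<Rightarrow> real^2" where
  "projected_velocity L c t = vector_derivative (\<lambda>s. fst (curve L c s)) (at t)"

text \<open>The parameter of a point of a simple closed curve is unique up to the period, so for a link
  in general position the following vector is well defined.\<close>

definition projected_tangent :: "link \<Rightarrow> (real^2) \<times> real \<Rightarrow> real^2" where
  "projected_tangent L p =
     (THE v. \<exists>c\<in>{1..num_components L}. \<exists>t. curve L c t = p \<and> v = projected_velocity L c t)"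

definition points_over :: "link \<Rightarrow> real^2 \<Rightarrow> ((real^2) \<times> real) set" where
  "points_over L x = {p \<in> link_set L. fst p = x}"

definition multiple_points :: "link \<Rightarrow> (real^2) set" where
  "multiple_points L = {x. \<exists>p q. p \<noteq> q \<and> p \<in> points_over L x \<and> q \<in> points_over L x}"

definition general_position :: "link \<Rightarrow> bool" where
  "general_position L \<longleftrightarrow>
     (\<forall>c\<in>{1..num_components L}.
        smooth_curve (curve L c) \<and>
        (\<forall>t. curve L c (t + 1) = curve L c t) \<and>
        inj_on (curve L c) {0..<1} \<and>
        (\<forall>t. projected_velocity L c t \<noteq> 0)) \<and>
     (\<forall>c\<in>{1..num_components L}. \<forall>d\<in>{1..num_components L}.
        c \<noteq> d \<longrightarrow> range (curve L c) \<inter> range (curve L d) = {}) \<and>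
     bij_betw (double_point L) {1..num_crossings L} (multiple_points L) \<and>
     (\<forall>x\<in>multiple_points L. card (points_over L x) = 2 \<and>
        (\<forall>p\<in>points_over L x. \<forall>q\<in>points_over L x.
           p \<noteq> q \<longrightarrow> span {projected_tangent L p, projected_tangent L q} = UNIV))"

definition positively_oriented :: "real^2 \<Rightarrow> real^2 \<Rightarrow> bool" where
  "positively_oriented v w \<longleftrightarrow> det (vector [v, w] :: real^2^2) > 0"

text \<open>The pair \<open>(p\<^sub>i\<^sup>+, p\<^sub>i\<^sup>-)\<close>; below, \<open>True\<close> stands for the label \<open>+\<close> and \<open>False\<close> for \<open>-\<close>.\<close>

definition crossing_pair :: "link \<Rightarrow> nat \<Rightarrow> ((real^2) \<times> real) \<times> ((real^2) \<times> real)" where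
  "crossing_pair L i =
     (THE (p, q). p \<in> points_over L (double_point L i) \<and> q \<in> points_over L (double_point L i) \<and>
        positively_oriented (projected_tangent L p) (projected_tangent L q))"

definition crossing_point :: "link \<Rightarrow> nat \<Rightarrow> bool \<Rightarrow> (real^2) \<times> real" where
  "crossing_point L i s = (if s then fst (crossing_pair L i) else snd (crossing_pair L i))"

definition crossing_sign :: "link \<Rightarrow> nat \<Rightarrow> real" where
  "crossing_sign L i = sgn (snd (crossing_point L i True) - snd (crossing_point L i False))"

definition removed_points :: "link \<Rightarrow> ((real^2) \<times> real) set" where
  "removed_points L = {crossing_point L i s | i s. i \<in> {1..num_crossings L}}"

type_synonym arc = "((real^2) \<times> real) set"

definition arcs :: "link \<Rightarrow> arc set" where
  "arcs L = components (link_set L - removed_points L)"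

definition arc_in :: "link \<Rightarrow> (real^2) \<times> real \<Rightarrow> arc" where
  "arc_in L p =
     (THE a. a \<in> arcs L \<and> (\<exists>c\<in>{1..num_components L}. \<exists>t. curve L c t = p \<and>
        (\<forall>\<^sub>F s in at_left t. curve L c s \<in> a)))"

definition arc_out :: "link \<Rightarrow> (real^2) \<times> real \<Rightarrow> arc" where
  "arc_out L p =
     (THE a. a \<in> arcs L \<and> (\<exists>c\<in>{1..num_components L}. \<exists>t. curve L c t = p \<and>
        (\<forall>\<^sub>F s in at_right t. curve L c s \<in> a)))"

section \<open>Polynomial functions of the arc matrices and derivations\<close>

text \<open>An assignment of matrices is a total function on sets of points; a polynomial function
  depends only on its values at the elements of \<open>A\<close>.\<close>

type_synonym ('a, 'n) matrix_function = "('a \<Rightarrow> complex^'n^'n) \<Rightarrow> complex"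

inductive_set polynomial_functions :: "'a set \<Rightarrow> ('a, 'n::finite) matrix_function set"
  for A :: "'a set" where
  const: "(\<lambda>h. c) \<in> polynomial_functions A"
| entry: "a \<in> A \<Longrightarrow> (\<lambda>h. h a $ i $ j) \<in> polynomial_functions A"
| add: "F \<in> polynomial_functions A \<Longrightarrow> G \<in> polynomial_functions A \<Longrightarrow>
    (\<lambda>h. F h + G h) \<in> polynomial_functions A"
| mult: "F \<in> polynomial_functions A \<Longrightarrow> G \<in> polynomial_functions A \<Longrightarrow>
    (\<lambda>h. F h * G h) \<in> polynomial_functions A"

definition derivation_on ::
  "('a, 'n::finite) matrix_function set \<Rightarrow>
   (('a, 'n) matrix_function \<Rightarrow> ('a, 'n) matrix_function) \<Rightarrow> bool" where
  "derivation_on P \<delta> \<longleftrightarrow>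
     (\<forall>F\<in>P. \<delta> F \<in> P) \<and>
     (\<forall>F\<in>P. \<forall>c. \<delta> (\<lambda>h. c * F h) = (\<lambda>h. c * \<delta> F h)) \<and>
     (\<forall>F\<in>P. \<forall>G\<in>P. \<delta> (\<lambda>h. F h + G h) = (\<lambda>h. \<delta> F h + \<delta> G h)) \<and>
     (\<forall>F\<in>P. \<forall>G\<in>P. \<delta> (\<lambda>h. F h * G h) = (\<lambda>h. \<delta> F h * G h + F h * \<delta> G h))"

text \<open>The derivation of the algebra of polynomial functions with \<open>h\<^sub>a \<mapsto> v a h\<close> (entrywise);
  it is made unique as a function on all functions by extending it by zero.\<close>

definition derivation_of ::
  "'a set \<Rightarrow> ('a \<Rightarrow> ('a \<Rightarrow> complex^'n^'n) \<Rightarrow> complex^'n^'n) \<Rightarrow>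
   ('a, 'n::finite) matrix_function \<Rightarrow> ('a, 'n) matrix_function" where
  "derivation_of A v =
     (THE \<delta>. derivation_on (polynomial_functions A) \<delta> \<and>
        (\<forall>a\<in>A. \<forall>i j. \<delta> (\<lambda>h. h a $ i $ j) = (\<lambda>h. v a h $ i $ j)) \<and>
        (\<forall>F. F \<notin> polynomial_functions A \<longrightarrow> \<delta> F = (\<lambda>h. 0)))"

section \<open>Reconnected Wilson loop functions\<close>

text \<open>Smoothing at the crossings in \<open>S\<close>: the arc ending at a removed point is followed by the arc
  starting there or, at a crossing in \<open>S\<close>, at the other point over the same double point. Closed
  arcs end at no removed point and follow themselves.\<close>

definition followed_by :: "link \<Rightarrow> nat set \<Rightarrow> arc \<Rightarrow> arc \<Rightarrow> bool" where
  "followed_by L S a b \<longleftrightarrow>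
     (\<exists>j\<in>{1..num_crossings L}. \<exists>s. a = arc_in L (crossing_point L j s) \<and>
        b = arc_out L (crossing_point L j (if j \<in> S then \<not> s else s)))"

definition next_arc :: "link \<Rightarrow> nat set \<Rightarrow> arc \<Rightarrow> arc" where
  "next_arc L S a = (if \<exists>b. followed_by L S a b then THE b. followed_by L S a b else a)"

definition cycle_from :: "('a \<Rightarrow> 'a) \<Rightarrow> 'a \<Rightarrow> 'a list" where
  "cycle_from f a = map (\<lambda>r. (f ^^ r) a) [0..<card (orbit f a)]"

definition matrix_list_prod :: "(complex^'n^'n) list \<Rightarrow> complex^'n::finite^'n" where
  "matrix_list_prod Ms = foldr (**) Ms (mat 1)"

text \<open>By cyclicity of the trace the choice of a starting arc in each cycle is irrelevant.\<close>

definition wilson :: "link \<Rightarrow> nat set \<Rightarrow> (arc, 'n::finite) matrix_function" where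
  "wilson L S h =
     (\<Prod>c\<in>orbit (next_arc L S) ` arcs L.
        trace (matrix_list_prod (map h (cycle_from (next_arc L S) (SOME a. a \<in> c)))))"

section \<open>Bases of the Lie algebras and the crossing operators\<close>

definition basis_gl :: "('b::finite \<Rightarrow> complex^'n::finite^'n) \<Rightarrow> bool" where
  "basis_gl e \<longleftrightarrow> inj e \<and>
     \<not> module.dependent (\<lambda>c M. \<chi> i j. c * M $ i $ j) (range e) \<and>
     module.span (\<lambda>c M. \<chi> i j. c * M $ i $ j) (range e) = UNIV"

definition lie_algebra_u :: "(complex^'n::finite^'n) set" where
  "lie_algebra_u = {M. (\<chi> i j. cnj (M $ j $ i)) = - M}"

definition basis_u :: "('b::finite \<Rightarrow> complex^'n::finite^'n) \<Rightarrow> bool" where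
  "basis_u e \<longleftrightarrow> inj e \<and> independent (range e) \<and> span (range e) = lie_algebra_u"

definition trace_form :: "('b::finite \<Rightarrow> complex^'n::finite^'n) \<Rightarrow> complex^'b^'b" where
  "trace_form e = (\<chi> \<alpha> \<beta>. trace (e \<alpha> ** e \<beta>))"

definition point_derivation ::
  "link \<Rightarrow> (real^2) \<times> real \<Rightarrow> complex^'n::finite^'n \<Rightarrow>
   (arc, 'n) matrix_function \<Rightarrow> (arc, 'n) matrix_function" where
  "point_derivation L p M =
     derivation_of (arcs L) (\<lambda>a h.
       (if a = arc_in L p then (1/2) *\<^sub>R (h a ** M) else 0) +
       (if a = arc_out L p then (1/2) *\<^sub>R (M ** h a) else 0))"

text \<open>The operator at the \<open>i\<close>-th double point with the sign of that crossing taken to be \<open>\<epsilon>\<close>.\<close>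

definition signed_crossing_operator ::
  "link \<Rightarrow> ('b::finite \<Rightarrow> complex^'n::finite^'n) \<Rightarrow> real \<Rightarrow> nat \<Rightarrow>
   (arc, 'n) matrix_function \<Rightarrow> (arc, 'n) matrix_function" where
  "signed_crossing_operator L e \<epsilon> i F =
     (\<lambda>h. 2 * of_real \<epsilon> * (\<Sum>\<alpha>\<in>UNIV. \<Sum>\<beta>\<in>UNIV. matrix_inv (trace_form e) $ \<alpha> $ \<beta> *
        point_derivation L (crossing_point L i True) (e \<alpha>)
          (point_derivation L (crossing_point L i False) (e \<beta>) F) h))"

definition crossing_operator ::
  "link \<Rightarrow> ('b::finite \<Rightarrow> complex^'n::finite^'n) \<Rightarrow> nat \<Rightarrow>
   (arc, 'n) matrix_function \<Rightarrow> (arc, 'n) matrix_function" where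
  "crossing_operator L e i = signed_crossing_operator L e (crossing_sign L i) i"

text \<open>On a finite-dimensional invariant space of polynomial functions the exponential series
  converges, and convergence there is pointwise convergence.\<close>

definition exp_operator ::
  "complex \<Rightarrow> (('a, 'n::finite) matrix_function \<Rightarrow> ('a, 'n) matrix_function) \<Rightarrow>
   ('a, 'n) matrix_function \<Rightarrow> ('a, 'n) matrix_function" where
  "exp_operator \<beta> D F = (\<lambda>h. \<Sum>r. \<beta> ^ r / fact r * (D ^^ r) F h)"

text \<open>The factors commute on polynomial functions; they are composed in the order of the
  numbering.\<close>

definition other_crossings ::
  "link \<Rightarrow> ('b::finite \<Rightarrow> complex^'n::finite^'n) \<Rightarrow> complex \<Rightarrow> nat \<Rightarrow>
   (arc, 'n) matrix_function \<Rightarrow> (arc, 'n) matrix_function" where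
  "other_crossings L e \<beta> i =
     foldr (\<lambda>j. exp_operator \<beta> (crossing_operator L e j))
       (filter (\<lambda>j. j \<noteq> i) [1..<Suc (num_crossings L)])"

end

theory Submission
  imports Defs
begin

text \<open>The function of a smoothing is a sum over labelings of the arc ends of products of matrix
  entries. On such a sum the invariant tensor acts, by the Fierz identity, by exchanging the
  labels of the two strands at the crossing. So the crossing operator with sign \<open>\<epsilon>\<close> sends
  \<open>W\<^sub>S\<close> to \<open>2 \<epsilon> W\<^sub>T\<close> and \<open>W\<^sub>T\<close> to \<open>\<epsilon> (n W\<^sub>T + W\<^sub>S)\<close>, where \<open>T = S \<union> {i}\<close>.
  The eigenvalues on the span of the two are \<open>\<epsilon> (n/2 \<plusminus> sqrt (n\<^sup>2/4 + 2))\<close>, and the exponentials at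
  the other crossings act on both with the same coefficients.\<close>

section \<open>Traces of cycles as state sums\<close>

text \<open>Written as state sums, all smoothings share the same arcs, and reconnecting at a
  crossing only exchanges two values of the successor permutation. So it need not be distinguished
  whether this merges two loops or splits one. The asymmetry between the two actions of the operator
  comes from the halves in the derivations. Each strand can be hit at the end of its incoming arc or
  at the start of its outgoing arc, which gives four terms of weight 1/4. Before smoothing all four
  reconnect the strands. After smoothing only two do; the other two pair an arc end with the start
  that already follows it and leave a free label, whence the \<open>n\<close>. The real form u(n)
  enters only through the fact that its real basis is a complex basis of all matrices. The
  exponential at \<open>i\<close> acts after those at the other crossings, so its two-dimensional
  formula is needed on \<open>Q (W S)\<close> and not just on \<open>W S\<close>; this is why
  \<open>Q (W S)\<close> is expanded into smoothings avoiding \<open>i\<close>. The exponentials are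
  pointwise series, so their linearity always comes with convergence of each summand.\<close>

abbreviation labelings :: "'a set \<Rightarrow> ('a \<Rightarrow> 'n) set" where
  "labelings A \<equiv> A \<rightarrow>\<^sub>E UNIV"

text \<open>The label of an arc is the matrix index at its start; the index at its end is the label
  of its successor. For a permutation \<open>f\<close> this is the product of the traces along the
  cycles of \<open>f\<close>, but the cycles themselves no longer appear.\<close>

definition state_sum :: "'a set \<Rightarrow> ('a \<Rightarrow> 'a) \<Rightarrow> ('a, 'n::finite) matrix_function" where
  "state_sum A f h = (\<Sum>l\<in>labelings A. \<Prod>a\<in>A. h a $ l a $ l (f a))"

lemma sum_labelings_insert:
  fixes F :: "('a \<Rightarrow> 'n::finite) \<Rightarrow> 'b::comm_monoid_add"
  assumes "x \<notin> A"
  shows "(\<Sum>l\<in>labelings (insert x A). F l) = (\<Sum>i\<in>UNIV. \<Sum>l\<in>labelings A. F (l(x := i)))"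
proof -
  have "inj_on (\<lambda>(y, g). g(x := y)) (UNIV \<times> labelings A)"
    using inj_combinator[OF assms, of "\<lambda>_. UNIV"] by simp
  then show ?thesis
    unfolding PiE_insert_eq by (subst sum.reindex) (simp_all add: sum.cartesian_product case_prod_unfold)
qed

lemma sum_labelings_Un:
  fixes F G :: "('a \<Rightarrow> 'n::finite) \<Rightarrow> 'b::comm_semiring_1"
  assumes "A \<inter> B = {}"
    and F: "\<And>l l'. (\<And>a. a \<in> A \<Longrightarrow> l a = l' a) \<Longrightarrow> F l = F l'"
    and G: "\<And>l l'. (\<And>a. a \<in> B \<Longrightarrow> l a = l' a) \<Longrightarrow> G l = G l'"
  shows "(\<Sum>l\<in>labelings (A \<union> B). F l * G l) = (\<Sum>l\<in>labelings A. F l) * (\<Sum>l\<in>labelings B. G l)"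
proof -
  let ?join = "\<lambda>(l, m) a. if a \<in> A then l a else m a"
  have "(\<Sum>l\<in>labelings A. F l) * (\<Sum>l\<in>labelings B. G l) =
      (\<Sum>p\<in>labelings A \<times> labelings B. F (fst p) * G (snd p))"
    by (simp add: sum_product sum.cartesian_product case_prod_unfold)
  also have "\<dots> = (\<Sum>l\<in>labelings (A \<union> B). F l * G l)"
  proof (rule sum.reindex_bij_witness[where j = ?join and i = "\<lambda>l. (restrict l A, restrict l B)"])
    fix p :: "('a \<Rightarrow> 'n) \<times> ('a \<Rightarrow> 'n)" assume p: "p \<in> labelings A \<times> labelings B"
    show "(restrict (?join p) A, restrict (?join p) B) = p"
      using p assms(1) by (auto simp: fun_eq_iff restrict_def PiE_def extensional_def)
    show "?join p \<in> labelings (A \<union> B)"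
      using p by (auto simp: PiE_def extensional_def split: if_splits)
    have "F (?join p) = F (fst p)" "G (?join p) = G (snd p)"
      using p assms(1) by (auto intro!: F G)
    then show "F (?join p) * G (?join p) = F (fst p) * G (snd p)" by simp
  next
    fix l :: "'a \<Rightarrow> 'n" assume "l \<in> labelings (A \<union> B)"
    then show "?join (restrict l A, restrict l B) = l"
      "(restrict l A, restrict l B) \<in> labelings A \<times> labelings B"
      by (auto simp: fun_eq_iff restrict_def PiE_def extensional_def)
  qed
  finally show ?thesis by simp
qed

text \<open>The path is open: \<open>j\<close> is the free index at its far end. Setting
  \<open>j\<close> to the label of the first entry closes it to a cycle.\<close>

primrec path_weight :: "('a \<Rightarrow> complex^'n^'n) \<Rightarrow> ('a \<Rightarrow> 'n) \<Rightarrow> 'n \<Rightarrow> 'a list \<Rightarrow> complex" where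
  "path_weight h l j [] = 1"
| "path_weight h l j (x # xs) =
     h x $ l x $ (case xs of [] \<Rightarrow> j | y # ys \<Rightarrow> l y) * path_weight h l j xs"

lemma path_weight_cong:
  "(\<And>a. a \<in> set xs \<Longrightarrow> l a = l' a) \<Longrightarrow> path_weight h l j xs = path_weight h l' j xs"
  by (induction xs) (auto split: list.splits)

lemma path_weight_nth:
  "path_weight h l j xs =
     (\<Prod>q<length xs. h (xs ! q) $ l (xs ! q) $ (if Suc q < length xs then l (xs ! Suc q) else j))"
proof (induction xs)
  case (Cons x xs)
  show ?case
    unfolding list.size path_weight.simps Cons.IH
    by (simp only: add_0_right add_Suc_right prod.lessThan_Suc_shift)
       (cases xs; simp)
qed simp

text \<open>Distinctness makes the labels of the entries independent summation variables, so each
  matrix product adds exactly one of them. The label of the head stays outside the sum as the row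
  index \<open>i\<close>.\<close>

lemma matrix_list_prod_nth:
  fixes h :: "'a \<Rightarrow> complex^'n::finite^'n"
  assumes "distinct (x # xs)"
  shows "matrix_list_prod (map h (x # xs)) $ i $ j =
    (\<Sum>l\<in>labelings (set xs). path_weight h (l(x := i)) j (x # xs))"
  using assms
proof (induction xs arbitrary: x i)
  case Nil
  show ?case by (simp add: matrix_list_prod_def)
next
  case (Cons y ys)
  have "matrix_list_prod (map h (x # y # ys)) $ i $ j =
      (\<Sum>k\<in>UNIV. h x $ i $ k * matrix_list_prod (map h (y # ys)) $ k $ j)"
    by (simp add: matrix_list_prod_def matrix_matrix_mult_def)
  also have "\<dots> = (\<Sum>k\<in>UNIV. \<Sum>l\<in>labelings (set ys). h x $ i $ k * path_weight h (l(y := k)) j (y # ys))"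
    using Cons.prems by (subst Cons.IH) (simp_all add: sum_distrib_left del: path_weight.simps)
  also have "\<dots> = (\<Sum>k\<in>UNIV. \<Sum>l\<in>labelings (set ys). path_weight h (l(y := k, x := i)) j (x # y # ys))"
  proof (intro sum.cong refl)
    fix k and l :: "'a \<Rightarrow> 'n"
    have "path_weight h (l(y := k, x := i)) j (y # ys) = path_weight h (l(y := k)) j (y # ys)"
      using Cons.prems by (intro path_weight_cong) auto
    then show "h x $ i $ k * path_weight h (l(y := k)) j (y # ys) =
        path_weight h (l(y := k, x := i)) j (x # y # ys)"
      using Cons.prems by (subst path_weight.simps(2)) auto
  qed
  also have "\<dots> = (\<Sum>l\<in>labelings (set (y # ys)). path_weight h (l(x := i)) j (x # y # ys))"
    using Cons.prems by (simp add: sum_labelings_insert del: path_weight.simps)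
  finally show ?case .
qed

lemma trace_matrix_list_prod:
  fixes h :: "'a \<Rightarrow> complex^'n::finite^'n"
  assumes "distinct (x # xs)"
  shows "trace (matrix_list_prod (map h (x # xs))) =
    (\<Sum>l\<in>labelings (set (x # xs)). path_weight h l (l x) (x # xs))"
  unfolding trace_def matrix_list_prod_nth[OF assms]
  using assms by (simp add: sum_labelings_insert del: path_weight.simps)

lemma trace_cycle_from:
  fixes h :: "'a \<Rightarrow> complex^'n::finite^'n"
  assumes "a \<in> orbit f a"
  shows "trace (matrix_list_prod (map h (cycle_from f a))) = state_sum (orbit f a) f h"
proof -
  define r where "r = card (orbit f a)"
  define xs where "xs = cycle_from f a"
  let ?g = "\<lambda>q. (f ^^ q) a"
  have "finite (orbit f a)" using assms by (rule finite_orbit)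
  have r_eq: "r = funpow_dist1 f a a"
    unfolding r_def
    by (subst orbit_conv_funpow_dist1[OF assms])
       (simp only: card_image[OF inj_on_funpow_dist1[OF assms]] card_atLeastLessThan diff_zero)
  have inj: "inj_on ?g {..<r}"
    using inj_on_funpow_dist1[OF assms] unfolding r_eq atLeast0LessThan .
  have img: "?g ` {..<r} = orbit f a"
    using orbit_conv_funpow_dist1[OF assms] unfolding r_eq atLeast0LessThan by simp
  have per: "?g r = a" using funpow_dist1_prop[OF assms] unfolding r_eq .
  have len: "length xs = r" unfolding xs_def cycle_from_def r_def by simp
  have nth: "xs ! q = ?g q" if "q < r" for q
    using that unfolding xs_def cycle_from_def r_def by simp
  have "r > 0" unfolding r_eq by simp
  have setxs: "set xs = orbit f a"
    unfolding xs_def cycle_from_def set_map set_upt r_def[symmetric] atLeast0LessThan by (rule img)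
  have "distinct xs"
    unfolding xs_def cycle_from_def distinct_map r_def[symmetric] set_upt atLeast0LessThan
    using inj by simp
  obtain y ys where xs: "xs = y # ys" using len \<open>r > 0\<close> by (cases xs) auto
  have "y = a" using nth[of 0] \<open>r > 0\<close> xs by simp
  have "trace (matrix_list_prod (map h xs)) =
      (\<Sum>l\<in>labelings (orbit f a). path_weight h l (l a) xs)"
    using trace_matrix_list_prod[of y ys h] \<open>distinct xs\<close> setxs unfolding xs \<open>y = a\<close> by simp
  also have "\<dots> = state_sum (orbit f a) f h"
    unfolding state_sum_def
  proof (intro sum.cong refl)
    fix l :: "'a \<Rightarrow> 'n"
    have "path_weight h l (l a) xs = (\<Prod>q<r. h (?g q) $ l (?g q) $ l (f (?g q)))"
      unfolding path_weight_nth len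
    proof (intro prod.cong refl)
      fix q assume q: "q \<in> {..<r}"
      show "h (xs ! q) $ l (xs ! q) $ (if Suc q < r then l (xs ! Suc q) else l a) =
          h (?g q) $ l (?g q) $ l (f (?g q))"
      proof (cases "Suc q < r")
        \<comment> \<open>The last entry has no successor in the list; there the closing index
          \<open>l a\<close> is correct because \<open>f\<close> returns to
          \<open>a\<close>.\<close>
        case False
        then have "r = Suc q" using q by simp
        then have "f (?g q) = a" using per by simp
        then show ?thesis using False q by (simp add: nth)
      qed (use q in \<open>simp add: nth\<close>)
    qed
    also have "\<dots> = (\<Prod>b\<in>?g ` {..<r}. h b $ l b $ l (f b))"
      by (simp add: prod.reindex[OF inj])
    finally show "path_weight h l (l a) xs = (\<Prod>b\<in>orbit f a. h b $ l b $ l (f b))"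
      unfolding img .
  qed
  finally show ?thesis unfolding xs_def .
qed

text \<open>Since \<open>f\<close> preserves each block, no factor couples labels of different
  blocks, and the sum over labelings factorizes.\<close>

lemma state_sum_Union:
  fixes h :: "'a \<Rightarrow> complex^'n::finite^'n"
  assumes "finite \<C>" "\<And>c. c \<in> \<C> \<Longrightarrow> finite c" "\<And>c. c \<in> \<C> \<Longrightarrow> f ` c \<subseteq> c" "disjoint \<C>"
  shows "(\<Prod>c\<in>\<C>. state_sum c f h) = state_sum (\<Union>\<C>) f h"
  using assms
proof (induction \<C> rule: finite_induct)
  case empty
  then show ?case by (simp add: state_sum_def)
next
  case (insert c \<C>)
  have disj: "c \<inter> \<Union>\<C> = {}"
    using insert.prems(3) insert.hyps(2) by (auto simp: disjoint_def)
  have fin: "finite c" "finite (\<Union>\<C>)" using insert by auto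
  have "f ` \<Union>\<C> \<subseteq> \<Union>\<C>" using insert.prems(2) by blast
  have "(\<Prod>c\<in>insert c \<C>. state_sum c f h) = state_sum c f h * state_sum (\<Union>\<C>) f h"
    using insert by (simp add: disjoint_def)
  also have "\<dots> = (\<Sum>l\<in>labelings (c \<union> \<Union>\<C>).
      (\<Prod>a\<in>c. h a $ l a $ l (f a)) * (\<Prod>a\<in>\<Union>\<C>. h a $ l a $ l (f a)))"
    unfolding state_sum_def
    using insert.prems(2)[of c] \<open>f ` \<Union>\<C> \<subseteq> \<Union>\<C>\<close>
    by (intro sum_labelings_Un[OF disj, symmetric] prod.cong refl) (metis image_subset_iff insertI1)+
  also have "\<dots> = state_sum (\<Union>(insert c \<C>)) f h"
    unfolding state_sum_def using fin disj by (simp add: prod.union_disjoint)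
  finally show ?case .
qed

text \<open>The state sum of an orbit does not mention a starting point, so the representative
  picked by \<open>SOME\<close> only has to lie in its orbit. This is the cyclicity of the
  trace.\<close>

lemma prod_orbit_traces:
  fixes h :: "'a \<Rightarrow> complex^'n::finite^'n"
  assumes f: "f permutes A" and "finite A"
  shows "(\<Prod>c\<in>orbit f ` A. trace (matrix_list_prod (map h (cycle_from f (SOME a. a \<in> c))))) =
    state_sum A f h"
proof -
  have perm: "permutation f" using assms by (auto simp: permutation_permutes)
  have self: "a \<in> orbit f a" for a using perm by (rule permutation_self_in_orbit)
  have orb: "orbit f b = orbit f a" if "b \<in> orbit f a" for a b
    using orbit_cyclic_eq3[OF cyclic_on_orbit'[OF perm] that] .
  have "(\<Prod>c\<in>orbit f ` A. trace (matrix_list_prod (map h (cycle_from f (SOME a. a \<in> c))))) =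
      (\<Prod>c\<in>orbit f ` A. state_sum c f h)"
  proof (intro prod.cong refl)
    fix c assume "c \<in> orbit f ` A"
    then obtain a where c: "c = orbit f a" by auto
    have "(SOME a. a \<in> c) \<in> c" using self[of a] unfolding c by (rule someI)
    then have "orbit f (SOME a. a \<in> c) = c" using orb c by simp
    then show "trace (matrix_list_prod (map h (cycle_from f (SOME a. a \<in> c)))) = state_sum c f h"
      using trace_cycle_from[OF self, of h] by simp
  qed
  also have "\<dots> = state_sum (\<Union>(orbit f ` A)) f h"
  proof (rule state_sum_Union)
    show "disjoint (orbit f ` A)"
      unfolding disjoint_def by (auto dest: orb)
  qed (use \<open>finite A\<close> self in \<open>auto intro: finite_orbit orbit.intros\<close>)
  also have "\<Union>(orbit f ` A) = A"
    using self permutes_orbit_subset[OF f] by blast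
  finally show ?thesis .
qed

section \<open>Derivations of polynomial functions\<close>

lemma polynomial_functions_sum:
  "(\<And>x. x \<in> X \<Longrightarrow> F x \<in> polynomial_functions A) \<Longrightarrow>
    (\<lambda>h. \<Sum>x\<in>X. F x h) \<in> polynomial_functions A"
  by (induction X rule: infinite_finite_induct)
     (auto intro: polynomial_functions.const polynomial_functions.add)

lemma polynomial_functions_prod:
  "(\<And>x. x \<in> X \<Longrightarrow> F x \<in> polynomial_functions A) \<Longrightarrow>
    (\<lambda>h. \<Prod>x\<in>X. F x h) \<in> polynomial_functions A"
  by (induction X rule: infinite_finite_induct)
     (auto intro: polynomial_functions.const polynomial_functions.mult)

lemma polynomial_functions_scale:
  "F \<in> polynomial_functions A \<Longrightarrow> (\<lambda>h. c * F h) \<in> polynomial_functions A"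
  by (rule polynomial_functions.mult[OF polynomial_functions.const])

text \<open>The line \<open>h + t * v h\<close> through the assignment \<open>h\<close>. The
  derivation sending each matrix variable to \<open>v\<close> is the directional derivative along it
  at \<open>t = 0\<close>.\<close>

definition displace ::
  "('a \<Rightarrow> ('a \<Rightarrow> complex^'n^'n) \<Rightarrow> complex^'n^'n) \<Rightarrow> ('a \<Rightarrow> complex^'n^'n) \<Rightarrow>
   complex \<Rightarrow> 'a \<Rightarrow> complex^'n^'n" where
  "displace v h t a = (\<chi> i j. h a $ i $ j + t * v a h $ i $ j)"

lemma displace_0: "displace v h 0 = h"
  by (simp add: displace_def fun_eq_iff vec_eq_iff)

lemma polynomial_differentiable:
  "F \<in> polynomial_functions A \<Longrightarrow> (\<lambda>t. F (displace v h t)) field_differentiable (at 0)"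
  by (induction F rule: polynomial_functions.induct)
     (auto simp: displace_def intro!: derivative_intros field_differentiable_add
        field_differentiable_mult field_differentiable_const field_differentiable_ident)

text \<open>The definite description behind \<open>derivation_of\<close> is meaningful only if such
  an operator exists. The analytic directional derivative supplies one, with all Leibniz rules
  inherited from calculus; polynomiality of its values follows by induction on the generation of the
  algebra.\<close>

lemma derivation_exists:
  fixes A :: "'a set" and v :: "'a \<Rightarrow> ('a \<Rightarrow> complex^'n::finite^'n) \<Rightarrow> complex^'n^'n"
  assumes v: "\<And>a i j. a \<in> A \<Longrightarrow> (\<lambda>h. v a h $ i $ j) \<in> polynomial_functions A"
  shows "\<exists>\<delta>. derivation_on (polynomial_functions A) \<delta> \<and>
     (\<forall>a\<in>A. \<forall>i j. \<delta> (\<lambda>h. h a $ i $ j) = (\<lambda>h. v a h $ i $ j)) \<and>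
     (\<forall>F. F \<notin> polynomial_functions A \<longrightarrow> \<delta> F = (\<lambda>h. 0))"
proof -
  let ?P = "polynomial_functions A :: ('a, 'n) matrix_function set"
  define d where "d F = (if F \<in> ?P then (\<lambda>h. deriv (\<lambda>t. F (displace v h t)) 0) else (\<lambda>h. 0))" for F
  note diff = polynomial_differentiable[where A = A and v = v]
  have const: "d (\<lambda>h. c) = (\<lambda>h. 0)" for c
    by (simp add: d_def)
  have entry: "d (\<lambda>h. h a $ i $ j) = (\<lambda>h. v a h $ i $ j)" if "a \<in> A" for a i j
  proof -
    have "((\<lambda>t. displace v h t a $ i $ j) has_field_derivative v a h $ i $ j) (at 0)" for h
      by (auto simp: displace_def intro!: derivative_eq_intros)
    then show ?thesis
      using polynomial_functions.entry[OF that, of i j] by (simp add: d_def fun_eq_iff DERIV_imp_deriv)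
  qed
  have add: "d (\<lambda>h. F h + G h) = (\<lambda>h. d F h + d G h)" if "F \<in> ?P" "G \<in> ?P" for F G
    using that by (simp add: d_def polynomial_functions.add diff)
  have mult: "d (\<lambda>h. F h * G h) = (\<lambda>h. d F h * G h + F h * d G h)" if "F \<in> ?P" "G \<in> ?P" for F G
    using that by (simp add: d_def polynomial_functions.mult diff displace_0 add.commute)
  have scale: "d (\<lambda>h. c * F h) = (\<lambda>h. c * d F h)" if "F \<in> ?P" for F c
    using mult[OF polynomial_functions.const that, of c] by (simp add: const)
  have closed: "d F \<in> ?P" if "F \<in> ?P" for F
    using that
  proof (induction F rule: polynomial_functions.induct)
    case (entry a i j)
    then show ?case by (simp add: \<open>\<And>a i j. a \<in> A \<Longrightarrow> d (\<lambda>h. h a $ i $ j) = (\<lambda>h. v a h $ i $ j)\<close> v)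
  qed (auto simp: const add mult intro: polynomial_functions.intros)
  show ?thesis
    unfolding derivation_on_def
    using closed scale add mult entry by (intro exI[of _ d]) (auto simp: d_def)
qed

lemma
  assumes "derivation_on P \<delta>"
  shows derivation_on_closed: "F \<in> P \<Longrightarrow> \<delta> F \<in> P"
    and derivation_on_scale: "F \<in> P \<Longrightarrow> \<delta> (\<lambda>h. c * F h) = (\<lambda>h. c * \<delta> F h)"
    and derivation_on_add: "F \<in> P \<Longrightarrow> G \<in> P \<Longrightarrow> \<delta> (\<lambda>h. F h + G h) = (\<lambda>h. \<delta> F h + \<delta> G h)"
    and derivation_on_mult:
      "F \<in> P \<Longrightarrow> G \<in> P \<Longrightarrow> \<delta> (\<lambda>h. F h * G h) = (\<lambda>h. \<delta> F h * G h + F h * \<delta> G h)"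
  using assms unfolding derivation_on_def by blast+

text \<open>The Leibniz rule for \<open>1 * 1\<close> forces the image of \<open>1\<close> to
  vanish, and scaling gives the other constants.\<close>

lemma derivation_on_const:
  assumes "derivation_on (polynomial_functions A) \<delta>"
  shows "\<delta> (\<lambda>h. c) = (\<lambda>h. 0)"
  using derivation_on_mult[OF assms polynomial_functions.const polynomial_functions.const, of 1 1]
    derivation_on_scale[OF assms polynomial_functions.const, of c 1]
  by (simp add: fun_eq_iff)

lemma derivation_unique:
  fixes \<delta> \<delta>' :: "('a, 'n::finite) matrix_function \<Rightarrow> ('a, 'n) matrix_function"
  assumes \<delta>: "derivation_on (polynomial_functions A) \<delta>"
    and \<delta>': "derivation_on (polynomial_functions A) \<delta>'"
    and "\<And>a i j. a \<in> A \<Longrightarrow> \<delta> (\<lambda>h. h a $ i $ j) = \<delta>' (\<lambda>h. h a $ i $ j)"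
    and F: "F \<in> polynomial_functions A"
  shows "\<delta> F = \<delta>' F"
  using F
proof (induction F rule: polynomial_functions.induct)
  case (entry a i j)
  then show ?case by (rule assms(3))
qed (simp_all add: derivation_on_const[OF \<delta>] derivation_on_const[OF \<delta>'] derivation_on_add[OF \<delta>]
      derivation_on_add[OF \<delta>'] derivation_on_mult[OF \<delta>] derivation_on_mult[OF \<delta>'])

lemma derivation_of:
  fixes A :: "'a set" and v :: "'a \<Rightarrow> ('a \<Rightarrow> complex^'n::finite^'n) \<Rightarrow> complex^'n^'n"
  assumes v: "\<And>a i j. a \<in> A \<Longrightarrow> (\<lambda>h. v a h $ i $ j) \<in> polynomial_functions A"
  shows "derivation_on (polynomial_functions A) (derivation_of A v)"
    and "a \<in> A \<Longrightarrow> derivation_of A v (\<lambda>h. h a $ i $ j) = (\<lambda>h. v a h $ i $ j)"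
proof -
  let ?C = "\<lambda>\<delta>. derivation_on (polynomial_functions A) \<delta> \<and>
     (\<forall>a\<in>A. \<forall>i j. \<delta> (\<lambda>h. h a $ i $ j) = (\<lambda>h. v a h $ i $ j)) \<and>
     (\<forall>F. F \<notin> polynomial_functions A \<longrightarrow> \<delta> F = (\<lambda>h. 0))"
  obtain \<delta> where \<delta>: "?C \<delta>"
    using derivation_exists[of A v] v by blast
  have "?C (derivation_of A v)"
    unfolding derivation_of_def
  proof (rule theI[of ?C, OF \<delta>])
    fix \<delta>' assume \<delta>': "?C \<delta>'"
    show "\<delta>' = \<delta>"
    proof
      fix F show "\<delta>' F = \<delta> F"
        using \<delta> \<delta>' derivation_unique[of A \<delta>' \<delta> F] by (cases "F \<in> polynomial_functions A") auto
    qed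
  qed
  then show "derivation_on (polynomial_functions A) (derivation_of A v)"
    and "a \<in> A \<Longrightarrow> derivation_of A v (\<lambda>h. h a $ i $ j) = (\<lambda>h. v a h $ i $ j)"
    by blast+
qed

lemma derivation_on_sum:
  fixes F :: "'x \<Rightarrow> ('a, 'n::finite) matrix_function"
  assumes \<delta>: "derivation_on (polynomial_functions A) \<delta>"
    and "\<And>x. x \<in> X \<Longrightarrow> F x \<in> polynomial_functions A"
  shows "\<delta> (\<lambda>h. \<Sum>x\<in>X. c x * F x h) = (\<lambda>h. \<Sum>x\<in>X. c x * \<delta> (F x) h)"
proof -
  show ?thesis
    using assms(2)
  proof (induction X rule: infinite_finite_induct)
    case (insert x X)
    have "(\<lambda>h. c x * F x h) \<in> polynomial_functions A"
      "(\<lambda>h. \<Sum>x\<in>X. c x * F x h) \<in> polynomial_functions A"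
      using insert.prems by (auto intro!: polynomial_functions_scale polynomial_functions_sum)
    then show ?case
      using insert by (simp add: derivation_on_add[OF \<delta>] derivation_on_scale[OF \<delta>])
  qed (simp_all add: derivation_on_const[OF \<delta>])
qed

lemma derivation_on_prod:
  fixes F :: "'x \<Rightarrow> ('a, 'n::finite) matrix_function"
  assumes \<delta>: "derivation_on (polynomial_functions A) \<delta>" and "finite X"
    and "\<And>x. x \<in> X \<Longrightarrow> F x \<in> polynomial_functions A"
  shows "\<delta> (\<lambda>h. \<Prod>x\<in>X. F x h) = (\<lambda>h. \<Sum>x\<in>X. \<delta> (F x) h * (\<Prod>y\<in>X - {x}. F y h))"
  using assms(2,3)
proof (induction X rule: finite_induct)
  case empty
  show ?case by (simp add: derivation_on_const[OF \<delta>])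
next
  case (insert x X)
  have "\<delta> (\<lambda>h. F x h * (\<Prod>x\<in>X. F x h)) =
      (\<lambda>h. \<delta> (F x) h * (\<Prod>x\<in>X. F x h) + F x h * \<delta> (\<lambda>h. \<Prod>x\<in>X. F x h) h)"
    using \<delta> insert.prems polynomial_functions_prod[of X F A]
    unfolding derivation_on_def by simp
  also have "\<dots> = (\<lambda>h. \<delta> (F x) h * (\<Prod>x\<in>X. F x h) +
      (\<Sum>y\<in>X. \<delta> (F y) h * (\<Prod>z\<in>insert x X - {y}. F z h)))"
  proof -
    have "insert x X - {y} = insert x (X - {y})" if "y \<in> X" for y
      using that insert.hyps by auto
    then show ?thesis
      using insert by (auto simp: fun_eq_iff sum_distrib_left mult_ac intro!: sum.cong)
  qed
  finally show ?case using insert.hyps by simp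
qed

section \<open>Insertion of a matrix where one arc is followed by another\<close>

definition monomial :: "'a set \<Rightarrow> ('a \<Rightarrow> 'n) \<Rightarrow> ('a \<Rightarrow> 'n) \<Rightarrow> ('a, 'n::finite) matrix_function" where
  "monomial A l r h = (\<Prod>a\<in>A. h a $ l a $ r a)"

lemma monomial_polynomial: "monomial A l r \<in> polynomial_functions A"
  unfolding monomial_def[abs_def]
  by (intro polynomial_functions_prod polynomial_functions.entry)

lemma monomial_cong:
  "(\<And>a. a \<in> A \<Longrightarrow> l a = l' a) \<Longrightarrow> (\<And>a. a \<in> A \<Longrightarrow> r a = r' a) \<Longrightarrow>
    monomial A l r h = monomial A l' r' h"
  unfolding monomial_def by (intro prod.cong refl) simp

text \<open>Each of the two arcs meeting at the point contributes one half, so a smoothing in which \<open>q\<close>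
  follows \<open>p\<close> gets a full factor \<open>M\<close> between the two.\<close>

definition insertion ::
  "'a set \<Rightarrow> 'a \<Rightarrow> 'a \<Rightarrow> complex^'n::finite^'n \<Rightarrow> ('a, 'n) matrix_function \<Rightarrow> ('a, 'n) matrix_function"
where
  "insertion A p q M = derivation_of A (\<lambda>a h.
     (if a = p then (1/2) *\<^sub>R (h a ** M) else 0) + (if a = q then (1/2) *\<^sub>R (M ** h a) else 0))"

lemma insertion_entry_polynomial:
  assumes "a \<in> A"
  shows "(\<lambda>h. ((if a = p then (1/2) *\<^sub>R (h a ** M) else 0) +
      (if a = q then (1/2) *\<^sub>R (M ** h a) else 0)) $ i $ j) \<in> polynomial_functions A"
proof -
  have *: "(\<lambda>h. ((1/2) *\<^sub>R (h a ** M)) $ i $ j) \<in> polynomial_functions A"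
    "(\<lambda>h. ((1/2) *\<^sub>R (M ** h a)) $ i $ j) \<in> polynomial_functions A"
    unfolding matrix_matrix_mult_def vector_scaleR_component vec_lambda_beta scaleR_conv_of_real
    using assms by (auto intro!: polynomial_functions_scale polynomial_functions_sum
        polynomial_functions.mult polynomial_functions.const polynomial_functions.entry)
  show ?thesis
    unfolding vector_add_component
    using * polynomial_functions.const[of 0 A]
    by (intro polynomial_functions.add) (cases "a = p"; cases "a = q"; simp)+
qed

lemma insertion_derivation: "derivation_on (polynomial_functions A) (insertion A p q M)"
  unfolding insertion_def by (rule derivation_of(1)) (rule insertion_entry_polynomial)

lemma insertion_entry:
  assumes "a \<in> A"
  shows "insertion A p q M (\<lambda>h. h a $ i $ j) =
    (\<lambda>h. ((if a = p then (1/2) *\<^sub>R (h a ** M) else 0) +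
      (if a = q then (1/2) *\<^sub>R (M ** h a) else 0)) $ i $ j)"
  unfolding insertion_def
  by (rule derivation_of(2)[OF insertion_entry_polynomial assms])

lemma insertion_polynomial:
  "F \<in> polynomial_functions A \<Longrightarrow> insertion A p q M F \<in> polynomial_functions A"
  by (rule derivation_on_closed[OF insertion_derivation])

lemmas insertion_sum = derivation_on_sum[OF insertion_derivation]

lemma half_scaleR_component:
  "((1/2) *\<^sub>R X) $ i $ j = 1/2 * (X $ i $ j)" for X :: "complex^'n^'m"
  by (simp only: vector_scaleR_component) (simp add: scaleR_conv_of_real)

text \<open>Every arc occurs exactly once in a monomial, so only the factors of \<open>p\<close> and
  \<open>q\<close> are affected. Multiplication from the right at \<open>p\<close> changes a column
  label, multiplication from the left at \<open>q\<close> a row label; this is why a monomial keeps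
  the two kinds of labels apart. The case \<open>p = q\<close> is included, with both
  contributions.\<close>

lemma insertion_monomial:
  fixes M :: "complex^'n::finite^'n"
  assumes A: "finite A" "p \<in> A" "q \<in> A"
  shows "insertion A p q M (monomial A l r) =
    (\<lambda>h. (\<Sum>s\<in>UNIV. 1/2 * M $ s $ r p * monomial A l (r(p := s)) h) +
         (\<Sum>s\<in>UNIV. 1/2 * M $ l q $ s * monomial A (l(q := s)) r h))"
proof
  fix h :: "'a \<Rightarrow> complex^'n^'n"
  let ?R = "\<lambda>a. \<Prod>b\<in>A - {a}. h b $ l b $ r b"
  have "insertion A p q M (monomial A l r) h =
      (\<Sum>a\<in>A. insertion A p q M (\<lambda>h. h a $ l a $ r a) h * ?R a)"
    unfolding monomial_def[abs_def]
    by (subst derivation_on_prod[OF insertion_derivation A(1)]) (auto intro: polynomial_functions.entry)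
  also have "\<dots> = (\<Sum>a\<in>A. (if a = p then ((1/2) *\<^sub>R (h p ** M)) $ l p $ r p * ?R p else 0) +
      (if a = q then ((1/2) *\<^sub>R (M ** h q)) $ l q $ r q * ?R q else 0))"
    by (intro sum.cong refl) (simp add: insertion_entry algebra_simps)
  also have "\<dots> = ((1/2) *\<^sub>R (h p ** M)) $ l p $ r p * ?R p + ((1/2) *\<^sub>R (M ** h q)) $ l q $ r q * ?R q"
    using A by (simp add: sum.distrib)
  also have "((1/2) *\<^sub>R (h p ** M)) $ l p $ r p * ?R p =
      (\<Sum>s\<in>UNIV. 1/2 * M $ s $ r p * monomial A l (r(p := s)) h)"
  proof -
    have "monomial A l (r(p := s)) h = h p $ l p $ s * ?R p" for s
      unfolding monomial_def using A by (subst prod.remove[of A p]) auto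
    then show ?thesis
      unfolding half_scaleR_component
      by (simp add: matrix_matrix_mult_def sum_distrib_left sum_distrib_right mult_ac)
  qed
  also have "((1/2) *\<^sub>R (M ** h q)) $ l q $ r q * ?R q =
      (\<Sum>s\<in>UNIV. 1/2 * M $ l q $ s * monomial A (l(q := s)) r h)"
  proof -
    have "monomial A (l(q := s)) r h = h q $ s $ r q * ?R q" for s
      unfolding monomial_def using A by (subst prod.remove[of A q]) auto
    then show ?thesis
      unfolding half_scaleR_component
      by (simp add: matrix_matrix_mult_def sum_distrib_left sum_distrib_right mult_ac)
  qed
  finally show "insertion A p q M (monomial A l r) h =
      (\<Sum>s\<in>UNIV. 1/2 * M $ s $ r p * monomial A l (r(p := s)) h) +
      (\<Sum>s\<in>UNIV. 1/2 * M $ l q $ s * monomial A (l(q := s)) r h)" .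
qed

section \<open>The Fierz identity\<close>

text \<open>The common ground of the two groups: a basis over the complex numbers of the space of
  all matrices, stated with explicit coefficients so that it can be used directly in index
  sums.\<close>

definition complex_basis :: "('b::finite \<Rightarrow> complex^'n::finite^'n) \<Rightarrow> bool" where
  "complex_basis e \<longleftrightarrow>
     (\<forall>M. \<exists>c. \<forall>i j. M $ i $ j = (\<Sum>\<gamma>\<in>UNIV. c \<gamma> * e \<gamma> $ i $ j)) \<and>
     (\<forall>c. (\<forall>i j. (\<Sum>\<gamma>\<in>UNIV. c \<gamma> * e \<gamma> $ i $ j) = 0) \<longrightarrow> (\<forall>\<gamma>. c \<gamma> = 0))"

lemma complex_basis_gl:
  fixes e :: "'b::finite \<Rightarrow> complex^'n::finite^'n"
  assumes "basis_gl e"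
  shows "complex_basis e"
proof -
  define sc where "sc = (\<lambda>c (M :: complex^'n^'n). (\<chi> i j. c * M $ i $ j) :: complex^'n^'n)"
  interpret module sc
    by unfold_locales (auto simp: sc_def vec_eq_iff algebra_simps)
  have inj: "inj e" and ind: "\<not> dependent (range e)" and sp: "span (range e) = UNIV"
    using assms unfolding basis_gl_def sc_def by auto
  have comb: "(\<Sum>x\<in>range e. sc (u x) x) $ i $ j = (\<Sum>\<gamma>\<in>UNIV. u (e \<gamma>) * e \<gamma> $ i $ j)" for u i j
    by (simp add: sum.reindex[OF inj] sc_def)
  show ?thesis
    unfolding complex_basis_def
  proof (intro conjI allI impI)
    fix M :: "complex^'n^'n"
    have "M \<in> span (range e)" using sp by simp
    then obtain u where "M = (\<Sum>x\<in>range e. sc (u x) x)"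
      unfolding span_finite[OF finite_imageI[OF finite]] by auto
    then show "\<exists>c. \<forall>i j. M $ i $ j = (\<Sum>\<gamma>\<in>UNIV. c \<gamma> * e \<gamma> $ i $ j)"
      using comb by (intro exI[of _ "\<lambda>\<gamma>. u (e \<gamma>)"]) simp
  next
    fix c \<gamma> assume c: "\<forall>i j. (\<Sum>\<gamma>\<in>UNIV. c \<gamma> * e \<gamma> $ i $ j) = 0"
    have "(\<Sum>x\<in>range e. sc ((c \<circ> inv e) x) x) = 0"
      using c comb[of "c \<circ> inv e"] by (simp add: vec_eq_iff inv_f_f[OF inj])
    then have "(c \<circ> inv e) (e \<gamma>) = 0"
      using ind dependent_finite[of "range e"] by auto
    then show "c \<gamma> = 0" by (simp add: inv_f_f[OF inj])
  qed
qed

text \<open>Every matrix is uniquely \<open>X + \<i> * Y\<close> with skew-Hermitian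
  \<open>X\<close> and \<open>Y\<close>, so complexifying u(n) gives all matrices.\<close>

lemma complex_basis_u:
  fixes e :: "'b::finite \<Rightarrow> complex^'n::finite^'n"
  assumes "basis_u e"
  shows "complex_basis e"
proof -
  have inj: "inj e" and ind: "independent (range e)" and sp: "span (range e) = lie_algebra_u"
    using assms unfolding basis_u_def by auto
  have comb: "(\<Sum>x\<in>range e. u x *\<^sub>R x) $ i $ j = (\<Sum>\<gamma>\<in>UNIV. of_real (u (e \<gamma>)) * e \<gamma> $ i $ j)" for u i j
    by (simp add: sum.reindex[OF inj]) (simp add: scaleR_conv_of_real)
  have real: "\<exists>a. \<forall>i j. M $ i $ j = (\<Sum>\<gamma>\<in>UNIV. of_real (a \<gamma>) * e \<gamma> $ i $ j)"
    if "M \<in> lie_algebra_u" for M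
  proof -
    have "M \<in> span (range e)" using sp that by simp
    then obtain u where "M = (\<Sum>x\<in>range e. u x *\<^sub>R x)"
      unfolding span_finite[OF finite_imageI[OF finite]] by auto
    then show ?thesis using comb by (intro exI[of _ "\<lambda>\<gamma>. u (e \<gamma>)"]) simp
  qed
  have skew: "cnj (e \<gamma> $ j $ i) = - e \<gamma> $ i $ j" for \<gamma> i j
  proof -
    have "e \<gamma> \<in> lie_algebra_u" using sp span_base[of "e \<gamma>" "range e"] by auto
    then show ?thesis by (simp add: lie_algebra_u_def vec_eq_iff)
  qed
  have real0: "a \<gamma> = 0" if "\<forall>i j. (\<Sum>\<gamma>\<in>UNIV. of_real (a \<gamma>) * e \<gamma> $ i $ j) = 0" for a \<gamma>
  proof -
    have "(\<Sum>x\<in>range e. (a \<circ> inv e) x *\<^sub>R x) = 0"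
      using that comb[of "a \<circ> inv e"] by (simp add: vec_eq_iff inv_f_f[OF inj])
    then have "(a \<circ> inv e) (e \<gamma>) = 0"
      using ind dependent_finite[of "range e"] by auto
    then show ?thesis by (simp add: inv_f_f[OF inj])
  qed
  show ?thesis
    unfolding complex_basis_def
  proof (intro conjI allI impI)
    fix M :: "complex^'n^'n"
    \<comment> \<open>\<open>X\<close> is the skew-Hermitian part of \<open>M\<close>, and
      \<open>\<i> * Y\<close> is its Hermitian part.\<close>
    define X Y where "X = ((\<chi> i j. (M $ i $ j - cnj (M $ j $ i)) / 2) :: complex^'n^'n)"
      and "Y = ((\<chi> i j. - \<i> * (M $ i $ j + cnj (M $ j $ i)) / 2) :: complex^'n^'n)"
    have "X \<in> lie_algebra_u" "Y \<in> lie_algebra_u"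
      by (auto simp: lie_algebra_u_def X_def Y_def vec_eq_iff field_simps)
    then obtain a b where "\<forall>i j. X $ i $ j = (\<Sum>\<gamma>\<in>UNIV. of_real (a \<gamma>) * e \<gamma> $ i $ j)"
      "\<forall>i j. Y $ i $ j = (\<Sum>\<gamma>\<in>UNIV. of_real (b \<gamma>) * e \<gamma> $ i $ j)"
      using real by meson
    moreover have "M $ i $ j = X $ i $ j + \<i> * Y $ i $ j" for i j
      by (simp add: X_def Y_def field_simps)
    ultimately show "\<exists>c. \<forall>i j. M $ i $ j = (\<Sum>\<gamma>\<in>UNIV. c \<gamma> * e \<gamma> $ i $ j)"
      by (intro exI[of _ "\<lambda>\<gamma>. of_real (a \<gamma>) + \<i> * of_real (b \<gamma>)"])
         (simp add: algebra_simps sum.distrib sum_distrib_left)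
  next
    fix c \<gamma> assume c: "\<forall>i j. (\<Sum>\<gamma>\<in>UNIV. c \<gamma> * e \<gamma> $ i $ j) = 0"
    \<comment> \<open>Conjugating and transposing a relation among skew-Hermitian matrices gives the
      relation with conjugate coefficients. Hence the real and the imaginary parts of the
      coefficients satisfy it separately.\<close>
    have conj_c: "(\<Sum>\<gamma>\<in>UNIV. cnj (c \<gamma>) * e \<gamma> $ i $ j) = 0" for i j
    proof -
      have "cnj (\<Sum>\<gamma>\<in>UNIV. c \<gamma> * e \<gamma> $ j $ i) = 0" using c by simp
      then show ?thesis by (simp add: skew sum_negf)
    qed
    have "(\<Sum>\<gamma>\<in>UNIV. of_real (Re (c \<gamma>)) * e \<gamma> $ i $ j) =
        ((\<Sum>\<gamma>\<in>UNIV. c \<gamma> * e \<gamma> $ i $ j) + (\<Sum>\<gamma>\<in>UNIV. cnj (c \<gamma>) * e \<gamma> $ i $ j)) / 2" for i j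
      unfolding sum.distrib[symmetric] sum_divide_distrib
      by (intro sum.cong refl) (simp add: complex_eq_iff field_simps)
    then have "Re (c \<gamma>) = 0" using c conj_c by (intro real0) simp
    moreover have "(\<Sum>\<gamma>\<in>UNIV. of_real (Im (c \<gamma>)) * e \<gamma> $ i $ j) =
        ((\<Sum>\<gamma>\<in>UNIV. c \<gamma> * e \<gamma> $ i $ j) - (\<Sum>\<gamma>\<in>UNIV. cnj (c \<gamma>) * e \<gamma> $ i $ j)) / (2 * \<i>)" for i j
      unfolding sum_subtractf[symmetric] sum_divide_distrib
      by (intro sum.cong refl) (simp add: left_diff_distrib[symmetric] complex_diff_cnj, simp add: complex_eq_iff)
    then have "Im (c \<gamma>) = 0" using c conj_c by (intro real0) simp
    ultimately show "c \<gamma> = 0" by (simp add: complex_eq_iff)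
  qed
qed

text \<open>Let \<open>c\<close> be the coordinates of the matrix unit with its 1 in row
  \<open>l\<close> and column \<open>k\<close>. Pairing this unit with \<open>e \<beta>\<close>
  under the trace yields the entry \<open>e \<beta> $ k $ l\<close>, so these entries are the trace
  form applied to \<open>c\<close>. The inverse form therefore returns \<open>c\<close>, and summing
  against \<open>e \<alpha>\<close> rebuilds the matrix unit.\<close>

lemma fierz_identity:
  fixes e :: "'b::finite \<Rightarrow> complex^'n::finite^'n"
  assumes "complex_basis e"
  shows "(\<Sum>\<alpha>\<in>UNIV. \<Sum>\<beta>\<in>UNIV. matrix_inv (trace_form e) $ \<alpha> $ \<beta> * (e \<alpha> $ i $ j * e \<beta> $ k $ l)) =
    (if i = l \<and> j = k then 1 else 0)"
proof -
  let ?g = "trace_form e"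
  let ?u = "\<lambda>p q. if p = l \<and> q = k then 1 else 0 :: complex"
  have span: "\<exists>c. \<forall>i j. M $ i $ j = (\<Sum>\<gamma>\<in>UNIV. c \<gamma> * e \<gamma> $ i $ j)" for M
    using assms unfolding complex_basis_def by blast
  have g: "?g $ \<alpha> $ \<beta> = (\<Sum>p\<in>UNIV. \<Sum>q\<in>UNIV. e \<alpha> $ p $ q * e \<beta> $ q $ p)" for \<alpha> \<beta>
    by (simp add: trace_form_def trace_def matrix_matrix_mult_def)
  have "invertible ?g"
  proof -
    have "x = 0" if x: "?g *v x = 0" for x
    proof -
      \<comment> \<open>A kernel vector \<open>x\<close> gives a matrix \<open>Y\<close> that is
        orthogonal under the trace to every basis element, hence to every matrix unit. So all
        entries of \<open>Y\<close> vanish, and independence of the basis gives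
        \<open>x = 0\<close>.\<close>
      define Y where "Y q p = (\<Sum>\<beta>\<in>UNIV. x $ \<beta> * e \<beta> $ q $ p)" for q p
      have orth: "(\<Sum>p\<in>UNIV. \<Sum>q\<in>UNIV. e \<alpha> $ p $ q * Y q p) = 0" for \<alpha>
      proof -
        have "(\<Sum>p\<in>UNIV. \<Sum>q\<in>UNIV. e \<alpha> $ p $ q * Y q p) =
            (\<Sum>p\<in>UNIV. \<Sum>q\<in>UNIV. \<Sum>\<beta>\<in>UNIV. e \<alpha> $ p $ q * e \<beta> $ q $ p * x $ \<beta>)"
          by (simp add: Y_def sum_distrib_left mult_ac)
        also have "\<dots> = (\<Sum>p\<in>UNIV. \<Sum>\<beta>\<in>UNIV. \<Sum>q\<in>UNIV. e \<alpha> $ p $ q * e \<beta> $ q $ p * x $ \<beta>)"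
          by (intro sum.cong refl sum.swap)
        also have "\<dots> = (\<Sum>\<beta>\<in>UNIV. \<Sum>p\<in>UNIV. \<Sum>q\<in>UNIV. e \<alpha> $ p $ q * e \<beta> $ q $ p * x $ \<beta>)"
          by (rule sum.swap)
        also have "\<dots> = (?g *v x) $ \<alpha>"
          by (simp add: matrix_vector_mult_def g sum_distrib_right)
        finally show ?thesis using x by simp
      qed
      have "Y k' l' = 0" for k' l'
      proof -
        obtain c where c: "\<And>p q. (if p = l' \<and> q = k' then 1 else 0) = (\<Sum>\<gamma>\<in>UNIV. c \<gamma> * e \<gamma> $ p $ q)"
          using span[of "\<chi> p q. if p = l' \<and> q = k' then 1 else 0"] by auto
        have "Y k' l' = (\<Sum>p\<in>UNIV. \<Sum>q\<in>UNIV. (if p = l' \<and> q = k' then 1 else 0) * Y q p)"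
          by (simp add: if_distrib[of "\<lambda>x. x * _"] sum.If_cases if_distribR
              flip: if_if_eq_conj cong: if_cong)
        also have "\<dots> = (\<Sum>p\<in>UNIV. \<Sum>q\<in>UNIV. \<Sum>\<gamma>\<in>UNIV. c \<gamma> * (e \<gamma> $ p $ q * Y q p))"
          by (simp only: c sum_distrib_right mult.assoc)
        also have "\<dots> = (\<Sum>p\<in>UNIV. \<Sum>\<gamma>\<in>UNIV. \<Sum>q\<in>UNIV. c \<gamma> * (e \<gamma> $ p $ q * Y q p))"
          by (intro sum.cong refl sum.swap)
        also have "\<dots> = (\<Sum>\<gamma>\<in>UNIV. \<Sum>p\<in>UNIV. \<Sum>q\<in>UNIV. c \<gamma> * (e \<gamma> $ p $ q * Y q p))"
          by (rule sum.swap)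
        also have "\<dots> = 0" by (simp only: sum_distrib_left[symmetric] orth) simp
        finally show ?thesis .
      qed
      then have "\<forall>\<gamma>. x $ \<gamma> = 0"
        using assms unfolding complex_basis_def Y_def by blast
      then show "x = 0" by (simp add: vec_eq_iff)
    qed
    then show ?thesis
      using matrix_left_invertible_ker[of ?g] invertible_left_inverse[of ?g] by blast
  qed
  then have inv: "matrix_inv ?g ** ?g = mat 1"
    unfolding invertible_def matrix_inv_def by (rule someI2_ex) blast
  obtain c where c: "\<And>p q. ?u p q = (\<Sum>\<gamma>\<in>UNIV. c \<gamma> * e \<gamma> $ p $ q)"
    using span[of "\<chi> p q. ?u p q"] by auto
  have e\<beta>: "e \<beta> $ k $ l = (\<Sum>\<gamma>\<in>UNIV. ?g $ \<beta> $ \<gamma> * c \<gamma>)" for \<beta>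
  proof -
    have "(\<Sum>\<gamma>\<in>UNIV. ?g $ \<beta> $ \<gamma> * c \<gamma>) =
        (\<Sum>\<gamma>\<in>UNIV. \<Sum>p\<in>UNIV. \<Sum>q\<in>UNIV. e \<beta> $ p $ q * (c \<gamma> * e \<gamma> $ q $ p))"
      by (simp add: g sum_distrib_left sum_distrib_right mult_ac)
    also have "\<dots> = (\<Sum>p\<in>UNIV. \<Sum>\<gamma>\<in>UNIV. \<Sum>q\<in>UNIV. e \<beta> $ p $ q * (c \<gamma> * e \<gamma> $ q $ p))"
      by (rule sum.swap)
    also have "\<dots> = (\<Sum>p\<in>UNIV. \<Sum>q\<in>UNIV. \<Sum>\<gamma>\<in>UNIV. e \<beta> $ p $ q * (c \<gamma> * e \<gamma> $ q $ p))"
      by (intro sum.cong refl sum.swap)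
    also have "\<dots> = (\<Sum>p\<in>UNIV. \<Sum>q\<in>UNIV. e \<beta> $ p $ q * ?u q p)"
      by (simp only: sum_distrib_left[symmetric] c)
    also have "\<dots> = e \<beta> $ k $ l"
      by (simp add: if_distrib[of "\<lambda>x. _ * x"] sum.If_cases if_distribR
              flip: if_if_eq_conj cong: if_cong)
    finally show ?thesis by simp
  qed
  have "(\<Sum>\<alpha>\<in>UNIV. \<Sum>\<beta>\<in>UNIV. matrix_inv ?g $ \<alpha> $ \<beta> * (e \<alpha> $ i $ j * e \<beta> $ k $ l)) =
      (\<Sum>\<alpha>\<in>UNIV. \<Sum>\<beta>\<in>UNIV. \<Sum>\<gamma>\<in>UNIV. e \<alpha> $ i $ j * (matrix_inv ?g $ \<alpha> $ \<beta> * ?g $ \<beta> $ \<gamma>) * c \<gamma>)"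
    by (simp add: e\<beta> sum_distrib_left mult_ac)
  also have "\<dots> = (\<Sum>\<alpha>\<in>UNIV. \<Sum>\<gamma>\<in>UNIV. \<Sum>\<beta>\<in>UNIV. e \<alpha> $ i $ j * (matrix_inv ?g $ \<alpha> $ \<beta> * ?g $ \<beta> $ \<gamma>) * c \<gamma>)"
    by (intro sum.cong refl sum.swap)
  also have "\<dots> = (\<Sum>\<alpha>\<in>UNIV. \<Sum>\<gamma>\<in>UNIV. e \<alpha> $ i $ j * (matrix_inv ?g ** ?g) $ \<alpha> $ \<gamma> * c \<gamma>)"
    by (simp add: matrix_matrix_mult_def sum_distrib_left sum_distrib_right)
  also have "\<dots> = (\<Sum>\<alpha>\<in>UNIV. c \<alpha> * e \<alpha> $ i $ j)"
    unfolding inv by (simp add: mat_def if_distrib[of "\<lambda>x. _ * x"] if_distrib[of "\<lambda>x. x * _"] mult.commute cong: if_cong)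
  also have "\<dots> = ?u i j" by (simp only: c)
  finally show ?thesis by simp
qed

section \<open>Contraction at a crossing\<close>

text \<open>Brings the sums over the basis inside the sums over the labels, where they form the
  tensor evaluated by the Fierz identity. Grouping the four indices into two pairs reduces the
  interchange to one swap.\<close>

lemma sum_contract:
  fixes g :: "'b::finite \<Rightarrow> 'b \<Rightarrow> complex" and u w :: "'b \<Rightarrow> 'n::finite \<Rightarrow> complex"
  shows "(\<Sum>\<alpha>\<in>UNIV. \<Sum>\<beta>\<in>UNIV. g \<alpha> \<beta> * (\<Sum>s\<in>UNIV. 1/2 * w \<beta> s * (\<Sum>t\<in>UNIV. 1/2 * u \<alpha> t * X s t))) =
    1/4 * (\<Sum>s\<in>UNIV. \<Sum>t\<in>UNIV. (\<Sum>\<alpha>\<in>UNIV. \<Sum>\<beta>\<in>UNIV. g \<alpha> \<beta> * (u \<alpha> t * w \<beta> s)) * X s t)"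
proof -
  let ?f = "\<lambda>\<alpha> \<beta> s t. 1/4 * (g \<alpha> \<beta> * (u \<alpha> t * w \<beta> s) * X s t)"
  have "(\<Sum>\<alpha>\<in>UNIV. \<Sum>\<beta>\<in>UNIV. g \<alpha> \<beta> * (\<Sum>s\<in>UNIV. 1/2 * w \<beta> s * (\<Sum>t\<in>UNIV. 1/2 * u \<alpha> t * X s t))) =
      (\<Sum>\<alpha>\<in>UNIV. \<Sum>\<beta>\<in>UNIV. \<Sum>s\<in>UNIV. \<Sum>t\<in>UNIV. ?f \<alpha> \<beta> s t)"
    by (simp add: sum_distrib_left mult_ac)
  also have "\<dots> = (\<Sum>p\<in>UNIV \<times> UNIV. \<Sum>q\<in>UNIV \<times> UNIV. ?f (fst p) (snd p) (fst q) (snd q))"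
    unfolding sum.cartesian_product' by simp
  also have "\<dots> = (\<Sum>q\<in>UNIV \<times> UNIV. \<Sum>p\<in>UNIV \<times> UNIV. ?f (fst p) (snd p) (fst q) (snd q))"
    by (rule sum.swap)
  also have "\<dots> = (\<Sum>s\<in>UNIV. \<Sum>t\<in>UNIV. \<Sum>\<alpha>\<in>UNIV. \<Sum>\<beta>\<in>UNIV. ?f \<alpha> \<beta> s t)"
    unfolding sum.cartesian_product' by simp
  also have "\<dots> = 1/4 * (\<Sum>s\<in>UNIV. \<Sum>t\<in>UNIV. (\<Sum>\<alpha>\<in>UNIV. \<Sum>\<beta>\<in>UNIV. g \<alpha> \<beta> * (u \<alpha> t * w \<beta> s)) * X s t)"
    by (simp only: sum_distrib_left sum_distrib_right)
  finally show ?thesis .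
qed

text \<open>Here \<open>p1\<close>, \<open>p2\<close> are the arcs ending and \<open>q1\<close>,
  \<open>q2\<close> the arcs starting at the two points over a crossing. An incoming arc may
  coincide with an outgoing one, as happens for a kink.\<close>

locale crossing =
  fixes A :: "'a set" and p1 q1 p2 q2 :: 'a and e :: "'b::finite \<Rightarrow> complex^'n::finite^'n"
  assumes finite: "finite A"
    and in_A: "p1 \<in> A" "q1 \<in> A" "p2 \<in> A" "q2 \<in> A"
    and distinct_arcs: "p1 \<noteq> p2" "q1 \<noteq> q2"
    and basis: "complex_basis e"
begin

definition contraction :: "('a, 'n) matrix_function \<Rightarrow> ('a, 'n) matrix_function" where
  "contraction F h = (\<Sum>\<alpha>\<in>UNIV. \<Sum>\<beta>\<in>UNIV. matrix_inv (trace_form e) $ \<alpha> $ \<beta> *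
     insertion A p1 q1 (e \<alpha>) (insertion A p2 q2 (e \<beta>) F) h)"

lemma contraction_sum:
  assumes "\<And>x. x \<in> X \<Longrightarrow> F x \<in> polynomial_functions A"
  shows "contraction (\<lambda>h. \<Sum>x\<in>X. c x * F x h) = (\<lambda>h. \<Sum>x\<in>X. c x * contraction (F x) h)"
proof
  fix h
  have "contraction (\<lambda>h. \<Sum>x\<in>X. c x * F x h) h =
      (\<Sum>\<alpha>\<in>UNIV. \<Sum>\<beta>\<in>UNIV. \<Sum>x\<in>X. c x * (matrix_inv (trace_form e) $ \<alpha> $ \<beta> *
        insertion A p1 q1 (e \<alpha>) (insertion A p2 q2 (e \<beta>) (F x)) h))"
    using assms
    by (simp add: contraction_def insertion_sum insertion_polynomial sum_distrib_left mult.left_commute)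
  also have "\<dots> = (\<Sum>\<alpha>\<in>UNIV. \<Sum>x\<in>X. \<Sum>\<beta>\<in>UNIV. c x * (matrix_inv (trace_form e) $ \<alpha> $ \<beta> *
        insertion A p1 q1 (e \<alpha>) (insertion A p2 q2 (e \<beta>) (F x)) h))"
    by (intro sum.cong refl sum.swap)
  also have "\<dots> = (\<Sum>x\<in>X. \<Sum>\<alpha>\<in>UNIV. \<Sum>\<beta>\<in>UNIV. c x * (matrix_inv (trace_form e) $ \<alpha> $ \<beta> *
        insertion A p1 q1 (e \<alpha>) (insertion A p2 q2 (e \<beta>) (F x)) h))"
    by (rule sum.swap)
  finally show "contraction (\<lambda>h. \<Sum>x\<in>X. c x * F x h) h = (\<Sum>x\<in>X. c x * contraction (F x) h)"
    by (simp add: contraction_def sum_distrib_left)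
qed

text \<open>By the Fierz identity, two insertions at arc ends exchange column labels, and two
  insertions at arc starts exchange row labels. An insertion at an end and one at a start instead
  test the two old labels for equality and replace both by one new label, which is summed.\<close>

lemma contraction_monomial:
  "contraction (monomial A l r) h = 1/4 * (
     monomial A l (r(p2 := r p1, p1 := r p2)) h + monomial A (l(q2 := l q1, q1 := l q2)) r h +
     (if r p1 = l q2 then \<Sum>s\<in>UNIV. monomial A (l(q2 := s)) (r(p1 := s)) h else 0) +
     (if r p2 = l q1 then \<Sum>s\<in>UNIV. monomial A (l(q1 := s)) (r(p2 := s)) h else 0))"
proof -
  let ?m = "\<lambda>l r. monomial A l r h"
  let ?g = "\<lambda>\<alpha> \<beta>. matrix_inv (trace_form e) $ \<alpha> $ \<beta>"
  have ins: "insertion A p1 q1 (e \<alpha>) (insertion A p2 q2 (e \<beta>) (monomial A l r)) h =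
      (\<Sum>s\<in>UNIV. 1/2 * e \<beta> $ s $ r p2 *
          (\<Sum>t\<in>UNIV. 1/2 * e \<alpha> $ t $ r p1 * ?m l (r(p2 := s, p1 := t)))) +
      (\<Sum>s\<in>UNIV. 1/2 * e \<beta> $ s $ r p2 *
          (\<Sum>t\<in>UNIV. 1/2 * e \<alpha> $ l q1 $ t * ?m (l(q1 := t)) (r(p2 := s)))) +
      ((\<Sum>s\<in>UNIV. 1/2 * e \<beta> $ l q2 $ s *
          (\<Sum>t\<in>UNIV. 1/2 * e \<alpha> $ t $ r p1 * ?m (l(q2 := s)) (r(p1 := t)))) +
      (\<Sum>s\<in>UNIV. 1/2 * e \<beta> $ l q2 $ s *
          (\<Sum>t\<in>UNIV. 1/2 * e \<alpha> $ l q1 $ t * ?m (l(q2 := s, q1 := t)) r)))" for \<alpha> \<beta>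
    unfolding insertion_monomial[OF finite in_A(3,4)]
    by (subst derivation_on_add[OF insertion_derivation])
       (use distinct_arcs in \<open>simp_all add: insertion_sum insertion_monomial[OF finite in_A(1,2)]
          monomial_polynomial polynomial_functions_sum polynomial_functions_scale
          distrib_left sum.distrib del: times_divide_eq_left mult_1\<close>)
  note fierz = fierz_identity[OF basis]
  have "contraction (monomial A l r) h =
      1/4 * (\<Sum>s\<in>UNIV. \<Sum>t\<in>UNIV. (if t = r p2 \<and> r p1 = s then 1 else 0) * ?m l (r(p2 := s, p1 := t))) +
      1/4 * (\<Sum>s\<in>UNIV. \<Sum>t\<in>UNIV. (if l q1 = r p2 \<and> t = s then 1 else 0) * ?m (l(q1 := t)) (r(p2 := s))) +
      (1/4 * (\<Sum>s\<in>UNIV. \<Sum>t\<in>UNIV. (if t = s \<and> r p1 = l q2 then 1 else 0) * ?m (l(q2 := s)) (r(p1 := t))) +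
      1/4 * (\<Sum>s\<in>UNIV. \<Sum>t\<in>UNIV. (if l q1 = s \<and> t = l q2 then 1 else 0) * ?m (l(q2 := s, q1 := t)) r))"
    unfolding contraction_def ins distrib_left sum.distrib sum_contract fierz ..
  also have "(\<Sum>s\<in>UNIV. \<Sum>t\<in>UNIV. (if t = r p2 \<and> r p1 = s then 1 else 0) * ?m l (r(p2 := s, p1 := t))) =
      ?m l (r(p2 := r p1, p1 := r p2))"
    by (simp add: if_distrib[of "\<lambda>x. x * _"] conj_commute flip: if_if_eq_conj cong: if_cong)
  also have "(\<Sum>s\<in>UNIV. \<Sum>t\<in>UNIV. (if l q1 = s \<and> t = l q2 then 1 else 0) * ?m (l(q2 := s, q1 := t)) r) =
      ?m (l(q2 := l q1, q1 := l q2)) r"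
    by (simp add: if_distrib[of "\<lambda>x. x * _"] conj_commute flip: if_if_eq_conj cong: if_cong)
  also have "(\<Sum>s\<in>UNIV. \<Sum>t\<in>UNIV. (if l q1 = r p2 \<and> t = s then 1 else 0) * ?m (l(q1 := t)) (r(p2 := s))) =
      (if r p2 = l q1 then \<Sum>s\<in>UNIV. ?m (l(q1 := s)) (r(p2 := s)) else 0)"
    by (auto simp: if_distrib[of "\<lambda>x. x * _"] cong: if_cong)
  also have "(\<Sum>s\<in>UNIV. \<Sum>t\<in>UNIV. (if t = s \<and> r p1 = l q2 then 1 else 0) * ?m (l(q2 := s)) (r(p1 := t))) =
      (if r p1 = l q2 then \<Sum>s\<in>UNIV. ?m (l(q2 := s)) (r(p1 := s)) else 0)"
    by (auto simp: if_distrib[of "\<lambda>x. x * _"] cong: if_cong)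
  finally show ?thesis by (simp only: distrib_left add_ac)
qed

end

section \<open>Reconnections produced by relabelling state sums\<close>

lemma state_sum_monomial: "state_sum A f = (\<lambda>h. \<Sum>l\<in>labelings A. 1 * monomial A l (l \<circ> f) h)"
  by (simp add: state_sum_def monomial_def fun_eq_iff)

lemma state_sum_polynomial: "state_sum A f \<in> polynomial_functions A"
  unfolding state_sum_monomial
  by (intro polynomial_functions_sum polynomial_functions_scale monomial_polynomial)

lemma sum_labelings_split:
  fixes F :: "('a \<Rightarrow> 'n::finite) \<Rightarrow> 'b::comm_monoid_add"
  assumes "b \<in> A"
  shows "(\<Sum>l\<in>labelings A. F l) = (\<Sum>l\<in>labelings (A - {b}). \<Sum>i\<in>UNIV. F (l(b := i)))"
proof -
  have "A = insert b (A - {b})" using assms by auto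
  then have "(\<Sum>l\<in>labelings A. F l) = (\<Sum>l\<in>labelings (insert b (A - {b})). F l)" by simp
  also have "\<dots> = (\<Sum>i\<in>UNIV. \<Sum>l\<in>labelings (A - {b}). F (l(b := i)))"
    by (rule sum_labelings_insert) simp
  also have "\<dots> = (\<Sum>l\<in>labelings (A - {b}). \<Sum>i\<in>UNIV. F (l(b := i)))"
    by (rule sum.swap)
  finally show ?thesis .
qed

text \<open>Here the reconnected permutation \<open>f'\<close> appears term by term: exchanging the
  column labels of \<open>p1\<close> and \<open>p2\<close> turns \<open>l \<circ> f\<close> into
  \<open>l \<circ> f'\<close>.\<close>

lemma sum_swap_ends:
  fixes h :: "'a \<Rightarrow> complex^'n::finite^'n"
  assumes "f' p1 = f p2" "f' p2 = f p1" "\<And>a. a \<in> A - {p1, p2} \<Longrightarrow> f' a = f a" "p1 \<noteq> p2"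
  shows "(\<Sum>l\<in>labelings A. monomial A l ((l \<circ> f)(p2 := (l \<circ> f) p1, p1 := (l \<circ> f) p2)) h) =
    state_sum A f' h"
  unfolding state_sum_monomial using assms
  by (auto intro!: sum.cong monomial_cong)

text \<open>Exchanging row labels matches \<open>f'\<close> only after the same exchange is applied
  to the summation variable \<open>l\<close>; it is an involution of the labelings, hence its own
  inverse witness. The outgoing arcs enter as an unordered pair, so the lemma serves the crossing
  with and without smoothing.\<close>

lemma sum_swap_starts:
  fixes h :: "'a \<Rightarrow> complex^'n::finite^'n"
  assumes f: "f permutes A" and A: "p1 \<in> A" "p2 \<in> A" "p1 \<noteq> p2"
    and f': "f' p1 = f p2" "f' p2 = f p1" "\<And>a. a \<in> A - {p1, p2} \<Longrightarrow> f' a = f a"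
    and q: "{q1, q2} = {f p1, f p2}"
  shows "(\<Sum>l\<in>labelings A. monomial A (l(q2 := l q1, q1 := l q2)) (l \<circ> f) h) = state_sum A f' h"
proof -
  have inj: "f a = f b \<longleftrightarrow> a = b" for a b using permutes_inj[OF f] by (auto dest: injD)
  have qA: "q1 \<in> A" "q2 \<in> A" using q A permutes_in_image[OF f] by (auto simp: doubleton_eq_iff)
  have "q1 \<noteq> q2" using q inj A(3) by (auto simp: doubleton_eq_iff)
  let ?t = "\<lambda>l :: 'a \<Rightarrow> 'n. l(q2 := l q1, q1 := l q2)"
  show ?thesis
    unfolding state_sum_monomial mult_1
  proof (rule sum.reindex_bij_witness[where i = ?t and j = ?t])
    fix l :: "'a \<Rightarrow> 'n" assume l: "l \<in> labelings A"
    show "?t (?t l) = l" using \<open>q1 \<noteq> q2\<close> by (auto simp: fun_eq_iff)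
    show "?t l \<in> labelings A" using l qA by (auto simp: PiE_def extensional_def)
    then show "?t l \<in> labelings A" .
    show "?t (?t l) = l" using \<open>q1 \<noteq> q2\<close> by (auto simp: fun_eq_iff)
    show "monomial A (?t l) (?t l \<circ> f') h = monomial A (?t l) (l \<circ> f) h"
    proof (rule monomial_cong)
      fix a assume "a \<in> A"
      then consider "a = p1" | "a = p2" | "a \<in> A - {p1, p2}" by auto
      then show "(?t l \<circ> f') a = (l \<circ> f) a"
        using f' q inj \<open>q1 \<noteq> q2\<close> by cases (auto simp: doubleton_eq_iff)
    qed simp
  qed
qed

text \<open>The equality test uses up the sum over the label of \<open>f p2\<close> by fixing it to
  that of \<open>f p1\<close>, as the new successor of \<open>p2\<close> requires. The fresh label
  \<open>s\<close> then takes the place of the label of \<open>f p2\<close>, now the successor of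
  \<open>p1\<close>.\<close>

lemma sum_reconnect:
  fixes h :: "'a \<Rightarrow> complex^'n::finite^'n"
  assumes f: "f permutes A" and A: "p1 \<in> A" "p2 \<in> A" "p1 \<noteq> p2"
    and f': "f' p1 = f p2" "f' p2 = f p1" "\<And>a. a \<in> A - {p1, p2} \<Longrightarrow> f' a = f a"
  shows "(\<Sum>l\<in>labelings A. if (l \<circ> f) p1 = l (f p2)
      then \<Sum>s\<in>UNIV. monomial A (l(f p2 := s)) ((l \<circ> f)(p1 := s)) h else 0) = state_sum A f' h"
proof -
  have inj: "f a = f b \<longleftrightarrow> a = b" for a b using permutes_inj[OF f] by (auto dest: injD)
  have qA: "f p2 \<in> A" using A permutes_in_image[OF f] by auto
  have "f p1 \<noteq> f p2" using inj A by simp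
  show ?thesis
    unfolding state_sum_monomial mult_1 sum_labelings_split[OF qA]
  proof (rule sum.cong[OF refl])
    fix l :: "'a \<Rightarrow> 'n"
    have "(\<Sum>i\<in>UNIV. if (l(f p2 := i) \<circ> f) p1 = (l(f p2 := i)) (f p2)
        then \<Sum>s\<in>UNIV. monomial A (l(f p2 := i, f p2 := s)) ((l(f p2 := i) \<circ> f)(p1 := s)) h else 0) =
        (\<Sum>s\<in>UNIV. monomial A (l(f p2 := s)) ((l(f p2 := l (f p1)) \<circ> f)(p1 := s)) h)"
      using \<open>f p1 \<noteq> f p2\<close> by simp
    also have "\<dots> = (\<Sum>s\<in>UNIV. monomial A (l(f p2 := s)) (l(f p2 := s) \<circ> f') h)"
    proof (intro sum.cong refl monomial_cong)
      fix s a assume "a \<in> A"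
      then consider "a = p1" | "a = p2" | "a \<in> A - {p1, p2}" by auto
      then show "((l(f p2 := l (f p1)) \<circ> f)(p1 := s)) a = (l(f p2 := s) \<circ> f') a"
        using f' inj A(3) \<open>f p1 \<noteq> f p2\<close> by cases auto
    qed
    finally show "(\<Sum>i\<in>UNIV. if (l(f p2 := i) \<circ> f) p1 = (l(f p2 := i)) (f p2)
        then \<Sum>s\<in>UNIV. monomial A (l(f p2 := i, f p2 := s)) ((l(f p2 := i) \<circ> f)(p1 := s)) h else 0) =
        (\<Sum>s\<in>UNIV. monomial A (l(f p2 := s)) (l(f p2 := s) \<circ> f') h)" .
  qed
qed

text \<open>The test compares a label with itself. The old label of \<open>f p\<close> is
  overwritten everywhere by \<open>s\<close>, so summing over it merely counts its values. This is
  the origin of \<open>n\<close> in the skein relation.\<close>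

lemma sum_loop:
  fixes h :: "'a \<Rightarrow> complex^'n::finite^'n"
  assumes f: "f permutes A" and A: "p \<in> A"
  shows "(\<Sum>l\<in>labelings A. if (l \<circ> f) p = l (f p)
      then \<Sum>s\<in>UNIV. monomial A (l(f p := s)) ((l \<circ> f)(p := s)) h else 0) =
    of_nat CARD('n) * state_sum A f h"
proof -
  have inj: "f a = f b \<longleftrightarrow> a = b" for a b using permutes_inj[OF f] by (auto dest: injD)
  have qA: "f p \<in> A" using A permutes_in_image[OF f] by auto
  show ?thesis
    unfolding state_sum_monomial mult_1 sum_labelings_split[OF qA] sum_distrib_left
  proof (rule sum.cong[OF refl])
    fix l :: "'a \<Rightarrow> 'n"
    have "monomial A (l(f p := i, f p := s)) ((l(f p := i) \<circ> f)(p := s)) h =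
        monomial A (l(f p := s)) (l(f p := s) \<circ> f) h" for i s
      using inj by (intro monomial_cong) auto
    then show "(\<Sum>i\<in>UNIV. if (l(f p := i) \<circ> f) p = (l(f p := i)) (f p)
        then \<Sum>s\<in>UNIV. monomial A (l(f p := i, f p := s)) ((l(f p := i) \<circ> f)(p := s)) h else 0) =
        (\<Sum>s\<in>UNIV. of_nat CARD('n) * monomial A (l(f p := s)) (l(f p := s) \<circ> f) h)"
      by (simp add: sum_distrib_left)
  qed
qed

context crossing
begin

text \<open>With strands passing straight through, the mixed terms test labels of different outgoing
  arcs, so all four terms reconnect. With the strands already exchanged, the mixed terms test a
  label against itself and become loops, while the other two terms undo the exchange.\<close>

lemma contraction_state_sum:
  assumes f: "f permutes A"
    and f': "f' p1 = f p2" "f' p2 = f p1" "\<And>a. a \<in> A - {p1, p2} \<Longrightarrow> f' a = f a"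
  shows "f p1 = q1 \<Longrightarrow> f p2 = q2 \<Longrightarrow> contraction (state_sum A f) h = state_sum A f' h"
    and "f p1 = q2 \<Longrightarrow> f p2 = q1 \<Longrightarrow>
      contraction (state_sum A f) h = 1/2 * (of_nat CARD('n) * state_sum A f h + state_sum A f' h)"
proof -
  have eq: "contraction (state_sum A f) h = (\<Sum>l\<in>labelings A. contraction (monomial A l (l \<circ> f)) h)"
    unfolding state_sum_monomial by (subst contraction_sum) (simp_all add: monomial_polynomial)
  note A = in_A(1,3) distinct_arcs(1)
  have f'2: "\<And>a. a \<in> A - {p2, p1} \<Longrightarrow> f' a = f a" using f'(3) by auto
  note ends = sum_swap_ends[where f = f and f' = f' and A = A and h = h, OF f' distinct_arcs(1)]
  note starts = sum_swap_starts[OF f A f', of q1 q2 h]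
  note reconnect1 = sum_reconnect[OF f A f', of h]
  note reconnect2 = sum_reconnect[OF f A(2,1) A(3)[symmetric] f'(2,1) f'2, of h]
  note loop1 = sum_loop[OF f A(1), of h]
  note loop2 = sum_loop[OF f A(2), of h]
  {
    assume q: "f p1 = q1" "f p2 = q2"
    then show "contraction (state_sum A f) h = state_sum A f' h"
      unfolding eq contraction_monomial sum_distrib_left[symmetric] sum.distrib
      using ends starts reconnect1[unfolded q] reconnect2[unfolded q] by simp
  next
    assume q: "f p1 = q2" "f p2 = q1"
    then show "contraction (state_sum A f) h =
        1/2 * (of_nat CARD('n) * state_sum A f h + state_sum A f' h)"
      unfolding eq contraction_monomial sum_distrib_left[symmetric] sum.distrib
      using ends starts loop1[unfolded q] loop2[unfolded q] by (simp add: insert_commute)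
  }
qed

end

section \<open>Arcs of a link in general position\<close>

locale positioned_link =
  fixes L :: link
  assumes general_position: "general_position L"
begin

lemma curve_period_int:
  assumes "c \<in> {1..num_components L}"
  shows "curve L c (t + of_int k) = curve L c t"
proof -
  have per: "curve L c (t + 1) = curve L c t" for t
    using general_position assms unfolding general_position_def by blast
  have nat: "curve L c (t + of_nat n) = curve L c t" for t n
  proof (induction n)
    case (Suc n)
    then show ?case using per[of "t + of_nat n"] by (simp add: add_ac)
  qed simp
  show ?thesis
  proof (cases "k \<ge> 0")
    case True
    then show ?thesis using nat[of t "nat k"] by simp
  next
    case False
    then show ?thesis using nat[of "t + of_int k" "nat (- k)"] by simp
  qed
qed

lemma curve_eq_iff:
  assumes c: "c \<in> {1..num_components L}" and d: "d \<in> {1..num_components L}"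
  shows "curve L c s = curve L d t \<longleftrightarrow> c = d \<and> (\<exists>k::int. t = s + of_int k)"
proof
  assume eq: "curve L c s = curve L d t"
  have "c = d"
  proof (rule ccontr)
    assume "c \<noteq> d"
    then have "range (curve L c) \<inter> range (curve L d) = {}"
      using general_position c d unfolding general_position_def by blast
    then show False using eq by (metis disjoint_iff rangeI)
  qed
  have "inj_on (curve L c) {0..<1}"
    using general_position c unfolding general_position_def by blast
  moreover have "curve L c (frac u) = curve L c u" for u
    using curve_period_int[OF c, of "frac u" "\<lfloor>u\<rfloor>"] by (simp add: frac_def)
  then have "curve L c (frac s) = curve L c (frac t)" using eq \<open>c = d\<close> by simp
  ultimately have "frac s = frac t"
    by (rule inj_onD) (auto simp: frac_lt_1)
  then have "t = s + of_int (\<lfloor>t\<rfloor> - \<lfloor>s\<rfloor>)" by (simp add: frac_def)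
  then show "c = d \<and> (\<exists>k::int. t = s + of_int k)" using \<open>c = d\<close> by blast
next
  assume "c = d \<and> (\<exists>k::int. t = s + of_int k)"
  then show "curve L c s = curve L d t" using curve_period_int[OF c] by auto
qed

lemma curve_continuous:
  assumes "c \<in> {1..num_components L}"
  shows "continuous_on A (curve L c)"
proof -
  have "smooth_curve (curve L c)"
    using general_position assms unfolding general_position_def by blast
  then obtain D where "\<And>t. (curve L c has_vector_derivative D t) (at t)"
    unfolding smooth_curve_def by metis
  then show ?thesis
    by (meson continuous_at_imp_continuous_on has_vector_derivative_continuous)
qed

lemma curve_reduce:
  assumes "c \<in> {1..num_components L}"
  obtains s' where "curve L c s' = curve L c s" "t \<le> s'" "s' < t + 1"
proof
  show "curve L c (t + frac (s - t)) = curve L c s"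
    using curve_period_int[OF assms, of "t + frac (s - t)" "\<lfloor>s - t\<rfloor>"] by (simp add: frac_def)
qed (auto simp: frac_lt_1)

lemma range_curve:
  assumes "c \<in> {1..num_components L}"
  shows "range (curve L c) = curve L c ` {t..t + 1}"
proof
  show "range (curve L c) \<subseteq> curve L c ` {t..t + 1}"
  proof (rule image_subsetI)
    fix s
    obtain s' where "curve L c s' = curve L c s" "t \<le> s'" "s' < t + 1"
      by (rule curve_reduce[OF assms])
    then show "curve L c s \<in> curve L c ` {t..t + 1}" by (intro image_eqI[of _ _ s']) auto
  qed
qed auto

lemma double_point_in: "i \<in> {1..num_crossings L} \<Longrightarrow> double_point L i \<in> multiple_points L"
  using general_position unfolding general_position_def bij_betw_def by blast

text \<open>Transversality makes the determinant nonzero and exchanging its rows flips the sign, so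
  exactly one ordering of two transverse strands is positive. The definite description in
  \<open>crossing_pair\<close> rests on this.\<close>

lemma positively_oriented_swap:
  "span {v, w} = UNIV \<Longrightarrow> positively_oriented v w \<longleftrightarrow> \<not> positively_oriented w v"
proof -
  assume span: "span {v, w} = UNIV"
  have "rows (vector [v, w] :: real^2^2) = range (($) (vector [v, w] :: real^2^2))"
    by (auto simp: rows_def row_def)
  also have "\<dots> = {v, w}" by (simp add: UNIV_2)
  finally have "rows (vector [v, w] :: real^2^2) = {v, w}" .
  then have "invertible (vector [v, w] :: real^2^2)"
    using span matrix_left_invertible_span_rows[of "vector [v, w] :: real^2^2"]
    by (simp add: invertible_left_inverse)
  then have "det (vector [v, w] :: real^2^2) \<noteq> 0"
    by (simp add: invertible_det_nz)
  then show ?thesis by (auto simp: positively_oriented_def det_2 mult.commute)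
qed

lemma crossing_points:
  assumes i: "i \<in> {1..num_crossings L}"
  shows "crossing_point L i True \<noteq> crossing_point L i False"
    and "points_over L (double_point L i) = {crossing_point L i True, crossing_point L i False}"
proof -
  let ?P = "points_over L (double_point L i)" and ?\<tau> = "projected_tangent L"
  have P: "card ?P = 2" "\<And>p q. p \<in> ?P \<Longrightarrow> q \<in> ?P \<Longrightarrow> p \<noteq> q \<Longrightarrow> span {?\<tau> p, ?\<tau> q} = UNIV"
    using double_point_in[OF i] general_position unfolding general_position_def by blast+
  obtain p q where pq: "?P = {p, q}" "p \<noteq> q" "positively_oriented (?\<tau> p) (?\<tau> q)"
  proof -
    obtain p q where "?P = {p, q}" "p \<noteq> q" using P(1) by (auto simp: card_2_iff)
    then show ?thesis
      using that[of p q] that[of q p] positively_oriented_swap[of "?\<tau> p" "?\<tau> q"] P(2)[of p q]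
      by (auto simp: insert_commute)
  qed
  then have "\<not> positively_oriented (?\<tau> q) (?\<tau> p)"
    using positively_oriented_swap P(2) by (metis insert_iff)
  \<comment> \<open>The description in \<open>crossing_pair\<close> does not require the two points
    to differ; coinciding points are excluded by the vanishing determinant.\<close>
  moreover have "\<not> positively_oriented v v" for v
    by (simp add: positively_oriented_def det_2)
  ultimately have "crossing_pair L i = (p, q)"
    unfolding crossing_pair_def using pq by (intro the_equality) auto
  then show "crossing_point L i True \<noteq> crossing_point L i False"
    and "?P = {crossing_point L i True, crossing_point L i False}"
    using pq by (auto simp: crossing_point_def)
qed

lemma crossing_point_eq_iff:
  assumes "i \<in> {1..num_crossings L}" "j \<in> {1..num_crossings L}"
  shows "crossing_point L i s = crossing_point L j s' \<longleftrightarrow> i = j \<and> s = s'"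
proof
  assume eq: "crossing_point L i s = crossing_point L j s'"
  have "fst (crossing_point L i s) = double_point L i" if "i \<in> {1..num_crossings L}" for i s
  proof -
    have "crossing_point L i s \<in> points_over L (double_point L i)"
      unfolding crossing_points(2)[OF that] by (cases s) auto
    then show ?thesis by (simp add: points_over_def)
  qed
  then have "double_point L i = double_point L j" using eq assms by metis
  then have "i = j"
    using assms general_position unfolding general_position_def bij_betw_def by (auto dest: inj_onD)
  then show "i = j \<and> s = s'"
    using eq crossing_points(1)[OF assms(1)] by (cases s; cases s') auto
qed auto

lemma removed_pointsE:
  assumes "p \<in> removed_points L"
  obtains i s where "i \<in> {1..num_crossings L}" "p = crossing_point L i s"
  using assms unfolding removed_points_def by blast

lemma crossing_point_removed: "i \<in> {1..num_crossings L} \<Longrightarrow> crossing_point L i s \<in> removed_points L"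
  unfolding removed_points_def by blast

lemma removed_subset: "removed_points L \<subseteq> link_set L"
proof
  fix p assume "p \<in> removed_points L"
  then obtain i s where i: "i \<in> {1..num_crossings L}" and "p = crossing_point L i s"
    by (rule removed_pointsE)
  then have "p \<in> points_over L (double_point L i)"
    unfolding crossing_points(2)[OF i] by (cases s) auto
  then show "p \<in> link_set L" by (simp add: points_over_def)
qed

lemma finite_removed: "finite (removed_points L)"
proof -
  have "removed_points L \<subseteq> (\<lambda>(i, s). crossing_point L i s) ` ({1..num_crossings L} \<times> UNIV)"
  proof
    fix p assume "p \<in> removed_points L"
    then obtain i s where "i \<in> {1..num_crossings L}" "p = crossing_point L i s"
      by (rule removed_pointsE)
    then show "p \<in> (\<lambda>(i, s). crossing_point L i s) ` ({1..num_crossings L} \<times> UNIV)"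
      by (intro image_eqI[of _ _ "(i, s)"]) auto
  qed
  then show ?thesis by (rule finite_subset) simp
qed

section \<open>Arcs as parameter intervals between consecutive removed points\<close>

lemma in_link_setE:
  assumes "p \<in> link_set L"
  obtains c t where "c \<in> {1..num_components L}" "p = curve L c t"
  using assms by (auto simp: link_set_def)

text \<open>Working with parameters rather than points keeps the orientation and the two ends of an
  arc visible. The value \<open>t' = t + 1\<close>, with both ends at the same point, is not
  excluded.\<close>

definition gap :: "nat \<Rightarrow> real \<Rightarrow> real \<Rightarrow> bool" where
  "gap c t t' \<longleftrightarrow> c \<in> {1..num_components L} \<and> t < t' \<and>
     curve L c t \<in> removed_points L \<and> curve L c t' \<in> removed_points L \<and>
     (\<forall>s\<in>{t<..<t'}. curve L c s \<notin> removed_points L)"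

lemma finite_cut_parameters:
  assumes c: "c \<in> {1..num_components L}" and I: "\<And>s s'. s \<in> I \<Longrightarrow> s' \<in> I \<Longrightarrow> \<bar>s - s'\<bar> < 1"
  shows "finite {s \<in> I. curve L c s \<in> removed_points L}"
proof (rule finite_imageD)
  show "finite (curve L c ` {s \<in> I. curve L c s \<in> removed_points L})"
    by (rule finite_subset[OF _ finite_removed]) auto
  show "inj_on (curve L c) {s \<in> I. curve L c s \<in> removed_points L}"
  proof (rule inj_onI)
    fix s s' assume s: "s \<in> {s \<in> I. curve L c s \<in> removed_points L}"
      "s' \<in> {s \<in> I. curve L c s \<in> removed_points L}" "curve L c s = curve L c s'"
    then obtain k :: int where "s' = s + of_int k" using curve_eq_iff[OF c c] by auto
    moreover have "\<bar>s - s'\<bar> < 1" using s I by blast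
    ultimately show "s = s'" by simp
  qed
qed

lemma next_cut:
  assumes c: "c \<in> {1..num_components L}" and u: "curve L c u \<in> removed_points L"
  obtains t where "s < t" "curve L c t \<in> removed_points L"
    "\<And>r. r \<in> {s<..<t} \<Longrightarrow> curve L c r \<notin> removed_points L"
proof -
  let ?T = "{r \<in> {s<..s + 1}. curve L c r \<in> removed_points L}"
  have fin: "finite ?T" by (rule finite_cut_parameters[OF c]) auto
  obtain v where v: "curve L c v = curve L c u" "s \<le> v" "v < s + 1"
    by (rule curve_reduce[OF c])
  \<comment> \<open>The representative \<open>v\<close> may be \<open>s\<close> itself, which the
    half-open window leaves out; one period later it lies in the window.\<close>
  have "?T \<noteq> {}"
    using v u curve_period_int[OF c, of v 1] by (cases "v = s") (auto intro: exI[of _ v] exI[of _ "v + 1"])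
  then obtain t where t: "t \<in> ?T" "\<And>r. r \<in> ?T \<Longrightarrow> t \<le> r"
    using Min_in[OF fin] Min_le[OF fin] by blast
  have "curve L c r \<notin> removed_points L" if "r \<in> {s<..<t}" for r
  proof
    assume "curve L c r \<in> removed_points L"
    then have "r \<in> ?T" using that t(1) by auto
    then show False using t(2) that by force
  qed
  then show ?thesis using t(1) by (intro that[of t]) auto
qed

lemma previous_cut:
  assumes c: "c \<in> {1..num_components L}" and u: "curve L c u \<in> removed_points L"
  obtains t where "t < s" "curve L c t \<in> removed_points L"
    "\<And>r. r \<in> {t<..<s} \<Longrightarrow> curve L c r \<notin> removed_points L"
proof -
  let ?T = "{r \<in> {s - 1..<s}. curve L c r \<in> removed_points L}"
  have fin: "finite ?T" by (rule finite_cut_parameters[OF c]) auto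
  obtain v where v: "curve L c v = curve L c u" "s - 1 \<le> v" "v < s - 1 + 1"
    by (rule curve_reduce[OF c])
  then have "v \<in> ?T" using u by simp
  then have "?T \<noteq> {}" by blast
  then obtain t where t: "t \<in> ?T" "\<And>r. r \<in> ?T \<Longrightarrow> r \<le> t"
    using Max_in[OF fin] Max_ge[OF fin] by blast
  have "curve L c r \<notin> removed_points L" if "r \<in> {t<..<s}" for r
  proof
    assume "curve L c r \<in> removed_points L"
    then have "r \<in> ?T" using that t(1) by auto
    then show False using t(2) that by force
  qed
  then show ?thesis using t(1) by (intro that[of t]) auto
qed

text \<open>The open piece of curve is connected, and it is both open and closed in the link without
  its removed points; a nonempty set of this kind is a connected component.\<close>

lemma gap_arc:
  assumes "gap c t t'"
  shows "curve L c ` {t<..<t'} \<in> arcs L"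
proof -
  let ?P = "curve L c ` {t<..<t'}" and ?Y = "link_set L - removed_points L"
  have c: "c \<in> {1..num_components L}" and "t < t'"
    and R: "curve L c t \<in> removed_points L" "curve L c t' \<in> removed_points L"
    and N: "\<And>s. s \<in> {t<..<t'} \<Longrightarrow> curve L c s \<notin> removed_points L"
    using assms unfolding gap_def by auto
  \<comment> \<open>The removed point at \<open>t\<close> recurs one period later, so the interval
    cannot extend beyond that.\<close>
  have "t' \<le> t + 1"
    using N[of "t + 1"] R(1) curve_period_int[OF c, of t 1] by force
  have "?P \<noteq> {}" using \<open>t < t'\<close> by simp
  have "?P \<subseteq> ?Y" using N c by (auto simp: link_set_def)
  have "connected ?P"
    by (intro connected_continuous_image curve_continuous[OF c]) auto
  have compact: "compact (curve L d ` {a..b})" if "d \<in> {1..num_components L}" for d a b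
    using curve_continuous[OF that] by (intro compact_continuous_image) auto
  have "?P = ?Y \<inter> curve L c ` {t..t'}"
  proof
    show "?Y \<inter> curve L c ` {t..t'} \<subseteq> ?P"
    proof
      fix y assume y: "y \<in> ?Y \<inter> curve L c ` {t..t'}"
      then obtain s where s: "s \<in> {t..t'}" "y = curve L c s" by blast
      then have "s \<noteq> t" "s \<noteq> t'" using R y by auto
      then show "y \<in> ?P" using s by auto
    qed
  qed (use \<open>?P \<subseteq> ?Y\<close> in auto)
  then have closed: "closedin (top_of_set ?Y) ?P"
    using closedin_closed_Int[of "curve L c ` {t..t'}" ?Y] compact_imp_closed[OF compact[OF c]] by simp
  \<comment> \<open>The rest of the link: all other components together with the remainder of this
    component. It is closed, being a finite union of compact sets, which gives openness of the
    piece.\<close>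
  let ?K = "(\<Union>d\<in>{1..num_components L} - {c}. range (curve L d)) \<union> curve L c ` {t'..t + 1}"
  have eq: "?P = ?Y \<inter> - ?K"
  proof
    show "?P \<subseteq> ?Y \<inter> - ?K"
    proof (intro Int_greatest \<open>?P \<subseteq> ?Y\<close> image_subsetI ComplI)
      fix s assume s: "s \<in> {t<..<t'}" and "curve L c s \<in> ?K"
      then consider d u where "d \<in> {1..num_components L}" "d \<noteq> c" "curve L c s = curve L d u"
        | u where "u \<in> {t'..t + 1}" "curve L c s = curve L c u" by blast
      then show False
      proof cases
        case 1
        then show False using curve_eq_iff[OF c] by blast
      next
        case 2
        then obtain k :: int where k: "u = s + of_int k" using curve_eq_iff[OF c c] by blast
        then have "0 < real_of_int k" "real_of_int k < 1" using s 2 \<open>t' \<le> t + 1\<close> by auto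
        then show False by simp
      qed
    qed
    show "?Y \<inter> - ?K \<subseteq> ?P"
    proof
      fix y assume y: "y \<in> ?Y \<inter> - ?K"
      then obtain d s where d: "d \<in> {1..num_components L}" "y = curve L d s"
        using in_link_setE by blast
      then have "d = c" using y by blast
      obtain s' where s': "curve L c s' = curve L c s" "t \<le> s'" "s' < t + 1"
        by (rule curve_reduce[OF c])
      have "y = curve L c s'" using d s' \<open>d = c\<close> by simp
      moreover have "s' \<in> {t<..<t'}"
      proof -
        have "s' \<noteq> t" using y R \<open>y = curve L c s'\<close> by auto
        moreover have "\<not> t' \<le> s'" using y s'(3) \<open>y = curve L c s'\<close> by auto
        ultimately show ?thesis using s'(2) by auto
      qed
      ultimately show "y \<in> ?P" by blast
    qed
  qed
  have "closed ?K"
  proof (intro closed_Un closed_UN ballI)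
    fix d assume "d \<in> {1..num_components L} - {c}"
    then show "closed (range (curve L d))"
      using range_curve[of d 0] compact_imp_closed[OF compact[of d]] by auto
  qed (auto intro: compact_imp_closed compact[OF c])
  then have "openin (top_of_set ?Y) (?Y \<inter> - ?K)"
    by (intro openin_open_Int open_Compl)
  then have "openin (top_of_set ?Y) ?P" by (simp only: eq)
  show ?thesis
    unfolding arcs_def in_components_maximal
  proof (intro conjI allI impI)
    fix D assume D: "D \<noteq> {} \<and> ?P \<subseteq> D \<and> D \<subseteq> ?Y \<and> connected D"
    then have "openin (top_of_set D) ?P" "closedin (top_of_set D) ?P"
      using openin_subset_trans[OF \<open>openin (top_of_set ?Y) ?P\<close>, of D]
        closedin_subset_trans[OF closed, of D] by blast+
    then show "D = ?P"
      using D \<open>?P \<noteq> {}\<close> unfolding connected_clopen by blast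
  qed (use \<open>?P \<noteq> {}\<close> \<open>?P \<subseteq> ?Y\<close> \<open>connected ?P\<close> in auto)
qed

lemma arcs_eqI: "a \<in> arcs L \<Longrightarrow> b \<in> arcs L \<Longrightarrow> x \<in> a \<Longrightarrow> x \<in> b \<Longrightarrow> a = b"
  unfolding arcs_def using components_nonoverlap by blast

lemma gap_shift:
  assumes "gap c t t'" "s - of_int k \<in> {t<..<t'}"
  shows "curve L c s \<in> curve L c ` {t<..<t'}"
proof -
  have "curve L c s = curve L c (s - of_int k)"
    using assms(1) curve_period_int[of c "s - of_int k" k] by (simp add: gap_def)
  then show ?thesis using assms(2) by blast
qed

text \<open>All parameters of the starting point differ from \<open>t\<close> by integers, and just
  after each of them the curve runs inside the gap. An arc that contains the curve there shares a
  point with this one, and distinct arcs are disjoint.\<close>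

lemma arc_out_gap:
  assumes g: "gap c t t'"
  shows "arc_out L (curve L c t) = curve L c ` {t<..<t'}"
  unfolding arc_out_def
proof (rule the_equality)
  have c: "c \<in> {1..num_components L}" and "t < t'" using g by (auto simp: gap_def)
  have ev: "\<forall>\<^sub>F s in at_right (t + of_int k). s - of_int k \<in> {t<..<t'}" for k :: int
    unfolding eventually_at_right_field using \<open>t < t'\<close>
    by (intro exI[of _ "t' + of_int k"]) auto
  show "curve L c ` {t<..<t'} \<in> arcs L \<and> (\<exists>d\<in>{1..num_components L}. \<exists>u. curve L d u = curve L c t \<and>
      (\<forall>\<^sub>F s in at_right u. curve L d s \<in> curve L c ` {t<..<t'}))"
    using ev[of 0] gap_arc[OF g] c by (auto intro!: bexI[of _ c] exI[of _ t] elim!: eventually_mono)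
  fix a assume "a \<in> arcs L \<and> (\<exists>d\<in>{1..num_components L}. \<exists>u. curve L d u = curve L c t \<and>
      (\<forall>\<^sub>F s in at_right u. curve L d s \<in> a))"
  then obtain d u where a: "a \<in> arcs L" and d: "d \<in> {1..num_components L}"
    "curve L c t = curve L d u" and u: "\<forall>\<^sub>F s in at_right u. curve L d s \<in> a" by force
  obtain k :: int where k: "d = c" "u = t + of_int k" using curve_eq_iff[OF c d(1)] d(2) by auto
  have "\<forall>\<^sub>F s in at_right u. curve L c s \<in> a \<and> s - of_int k \<in> {t<..<t'}"
    using u ev[of k] unfolding k by (rule eventually_conj)
  then obtain s where "curve L c s \<in> a" "s - of_int k \<in> {t<..<t'}"
    using eventually_happens[of _ "at_right u"] by auto
  then show "a = curve L c ` {t<..<t'}"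
    using arcs_eqI[OF a gap_arc[OF g]] gap_shift[OF g] by blast
qed

lemma arc_in_gap:
  assumes g: "gap c t t'"
  shows "arc_in L (curve L c t') = curve L c ` {t<..<t'}"
  unfolding arc_in_def
proof (rule the_equality)
  have c: "c \<in> {1..num_components L}" and "t < t'" using g by (auto simp: gap_def)
  have ev: "\<forall>\<^sub>F s in at_left (t' + of_int k). s - of_int k \<in> {t<..<t'}" for k :: int
    unfolding eventually_at_left_field using \<open>t < t'\<close>
    by (intro exI[of _ "t + of_int k"]) auto
  show "curve L c ` {t<..<t'} \<in> arcs L \<and> (\<exists>d\<in>{1..num_components L}. \<exists>u. curve L d u = curve L c t' \<and>
      (\<forall>\<^sub>F s in at_left u. curve L d s \<in> curve L c ` {t<..<t'}))"
    using ev[of 0] gap_arc[OF g] c by (auto intro!: bexI[of _ c] exI[of _ t'] elim!: eventually_mono)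
  fix a assume "a \<in> arcs L \<and> (\<exists>d\<in>{1..num_components L}. \<exists>u. curve L d u = curve L c t' \<and>
      (\<forall>\<^sub>F s in at_left u. curve L d s \<in> a))"
  then obtain d u where a: "a \<in> arcs L" and d: "d \<in> {1..num_components L}"
    "curve L c t' = curve L d u" and u: "\<forall>\<^sub>F s in at_left u. curve L d s \<in> a" by force
  obtain k :: int where k: "d = c" "u = t' + of_int k" using curve_eq_iff[OF c d(1)] d(2) by auto
  have "\<forall>\<^sub>F s in at_left u. curve L c s \<in> a \<and> s - of_int k \<in> {t<..<t'}"
    using u ev[of k] unfolding k by (rule eventually_conj)
  then obtain s where "curve L c s \<in> a" "s - of_int k \<in> {t<..<t'}"
    using eventually_happens[of _ "at_left u"] by auto
  then show "a = curve L c ` {t<..<t'}"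
    using arcs_eqI[OF a gap_arc[OF g]] gap_shift[OF g] by blast
qed

text \<open>After a shift by a whole period the two intervals have a common parameter, the midpoint
  of the first. Neither has a cut in its interior and both end at cuts, so differing endpoints would
  put a cut of one inside the other. This yields injectivity of \<open>arc_in\<close> and
  \<open>arc_out\<close>.\<close>

lemma gap_unique:
  assumes g: "gap c t t'" and h: "gap d s s'"
    and eq: "curve L c ` {t<..<t'} = curve L d ` {s<..<s'}"
  shows "curve L c t = curve L d s" "curve L c t' = curve L d s'"
proof -
  have c: "c \<in> {1..num_components L}" and d: "d \<in> {1..num_components L}" and "t < t'" "s < s'"
    using g h by (auto simp: gap_def)
  have "curve L c ((t + t') / 2) \<in> curve L d ` {s<..<s'}"
    using \<open>t < t'\<close> unfolding eq[symmetric] by (intro imageI) auto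
  then obtain v where v: "v \<in> {s<..<s'}" "curve L c ((t + t') / 2) = curve L d v" by auto
  then obtain k :: int where k: "d = c" "v = (t + t') / 2 + of_int k"
    using curve_eq_iff[OF c d] by auto
  have per: "curve L c (u + of_int k) = curve L c u" for u by (rule curve_period_int[OF c])
  have g': "curve L c (t + of_int k) \<in> removed_points L" "curve L c (t' + of_int k) \<in> removed_points L"
    using g unfolding per gap_def by auto
  have g'': "curve L c u \<notin> removed_points L" if "t + of_int k < u" "u < t' + of_int k" for u
    using that g curve_period_int[OF c, of "u - of_int k" k] unfolding gap_def by force
  have h': "curve L c s \<in> removed_points L" "curve L c s' \<in> removed_points L"
    and h'': "\<And>u. s < u \<Longrightarrow> u < s' \<Longrightarrow> curve L c u \<notin> removed_points L"
    using h unfolding k gap_def by auto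
  have v': "t + of_int k < v" "v < t' + of_int k" "s < v" "v < s'"
    using v k \<open>t < t'\<close> by auto
  have "s = t + of_int k"
    using h'(1) g'(1) g''[of s] h''[of "t + of_int k"] v' by fastforce
  moreover have "s' = t' + of_int k"
    using h'(2) g'(2) g''[of s'] h''[of "t' + of_int k"] v' by fastforce
  ultimately show "curve L c t = curve L d s" "curve L c t' = curve L d s'"
    using per \<open>d = c\<close> by auto
qed

lemma gap_from:
  assumes "p \<in> removed_points L"
  obtains c t t' where "gap c t t'" "p = curve L c t"
proof -
  obtain c t where c: "c \<in> {1..num_components L}" and p: "p = curve L c t"
    using assms removed_subset in_link_setE by blast
  obtain t' where "t < t'" "curve L c t' \<in> removed_points L"
    "\<And>r. r \<in> {t<..<t'} \<Longrightarrow> curve L c r \<notin> removed_points L"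
    using next_cut[OF c, of t t] assms p by blast
  then have "gap c t t'" using c assms p by (simp add: gap_def)
  then show ?thesis using that p by blast
qed

lemma gap_to:
  assumes "p \<in> removed_points L"
  obtains c t t' where "gap c t t'" "p = curve L c t'"
proof -
  obtain c t' where c: "c \<in> {1..num_components L}" and p: "p = curve L c t'"
    using assms removed_subset in_link_setE by blast
  obtain t where "t < t'" "curve L c t \<in> removed_points L"
    "\<And>r. r \<in> {t<..<t'} \<Longrightarrow> curve L c r \<notin> removed_points L"
    using previous_cut[OF c, of t' t'] assms p by blast
  then have "gap c t t'" using c assms p by (simp add: gap_def)
  then show ?thesis using that p by blast
qed

lemma gap_around:
  assumes c: "c \<in> {1..num_components L}" "curve L c u \<in> removed_points L"
    and s: "curve L c s \<notin> removed_points L"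
  obtains t t' where "gap c t t'" "s \<in> {t<..<t'}"
proof -
  obtain t where t: "t < s" "curve L c t \<in> removed_points L"
    "\<And>r. r \<in> {t<..<s} \<Longrightarrow> curve L c r \<notin> removed_points L"
    using previous_cut[OF c, of s] by blast
  obtain t' where t': "s < t'" "curve L c t' \<in> removed_points L"
    "\<And>r. r \<in> {s<..<t'} \<Longrightarrow> curve L c r \<notin> removed_points L"
    using next_cut[OF c, of s] by blast
  have "curve L c r \<notin> removed_points L" if "r \<in> {t<..<t'}" for r
    using that t(3)[of r] t'(3)[of r] s by (cases r s rule: linorder_cases) auto
  then have "gap c t t'" using c t t' by (simp add: gap_def)
  then show ?thesis using that t t' by simp
qed

lemma arc_out_in_arcs: "p \<in> removed_points L \<Longrightarrow> arc_out L p \<in> arcs L"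
  by (erule gap_from) (simp only: arc_out_gap gap_arc)

lemma arc_in_in_arcs: "p \<in> removed_points L \<Longrightarrow> arc_in L p \<in> arcs L"
  by (erule gap_to) (simp only: arc_in_gap gap_arc)

lemma inj_on_arc_out: "inj_on (arc_out L) (removed_points L)"
proof (rule inj_onI)
  fix p q assume pq: "p \<in> removed_points L" "q \<in> removed_points L" "arc_out L p = arc_out L q"
  obtain c t t' where g: "gap c t t'" "p = curve L c t" by (rule gap_from[OF pq(1)])
  obtain d s s' where h: "gap d s s'" "q = curve L d s" by (rule gap_from[OF pq(2)])
  have "curve L c ` {t<..<t'} = curve L d ` {s<..<s'}"
    using pq(3) unfolding g(2) h(2) arc_out_gap[OF g(1)] arc_out_gap[OF h(1)] .
  then show "p = q" unfolding g(2) h(2) by (rule gap_unique(1)[OF g(1) h(1)])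
qed

lemma inj_on_arc_in: "inj_on (arc_in L) (removed_points L)"
proof (rule inj_onI)
  fix p q assume pq: "p \<in> removed_points L" "q \<in> removed_points L" "arc_in L p = arc_in L q"
  obtain c t t' where g: "gap c t t'" "p = curve L c t'" by (rule gap_to[OF pq(1)])
  obtain d s s' where h: "gap d s s'" "q = curve L d s'" by (rule gap_to[OF pq(2)])
  have "curve L c ` {t<..<t'} = curve L d ` {s<..<s'}"
    using pq(3) unfolding g(2) h(2) arc_in_gap[OF g(1)] arc_in_gap[OF h(1)] .
  then show "p = q" unfolding g(2) h(2) by (rule gap_unique(2)[OF g(1) h(1)])
qed

text \<open>A gap is cut at both ends. Hence passing from an incoming to an outgoing arc never
  leaves the set of arcs with ends, and closed arcs stay apart.\<close>

lemma arc_in_image: "arc_in L ` removed_points L = arc_out L ` removed_points L"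
proof
  show "arc_in L ` removed_points L \<subseteq> arc_out L ` removed_points L"
  proof (rule image_subsetI)
    fix p assume "p \<in> removed_points L"
    then obtain c t t' where g: "gap c t t'" "p = curve L c t'" by (rule gap_to)
    have "arc_in L p = arc_out L (curve L c t)"
      unfolding g(2) arc_in_gap[OF g(1)] arc_out_gap[OF g(1)] ..
    then show "arc_in L p \<in> arc_out L ` removed_points L" using g by (simp add: gap_def)
  qed
  show "arc_out L ` removed_points L \<subseteq> arc_in L ` removed_points L"
  proof (rule image_subsetI)
    fix p assume "p \<in> removed_points L"
    then obtain c t t' where g: "gap c t t'" "p = curve L c t" by (rule gap_from)
    have "arc_out L p = arc_in L (curve L c t')"
      unfolding g(2) arc_in_gap[OF g(1)] arc_out_gap[OF g(1)] ..
    then show "arc_out L p \<in> arc_in L ` removed_points L" using g by (simp add: gap_def)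
  qed
qed

text \<open>On a curve with cuts, an arc is the outgoing arc of a removed point; a curve without
  cuts lies in the component of its base point. Both kinds are finite in number.\<close>

lemma finite_arcs: "finite (arcs L)"
proof -
  let ?Y = "link_set L - removed_points L"
  have "arcs L \<subseteq> arc_out L ` removed_points L \<union>
      (\<lambda>c. connected_component_set ?Y (curve L c 0)) ` {1..num_components L}"
  proof
    fix a assume a: "a \<in> arcs L"
    then obtain y where y: "y \<in> ?Y" "a = connected_component_set ?Y y"
      unfolding arcs_def components_def by auto
    then have "y \<in> a" by simp
    obtain c s where c: "c \<in> {1..num_components L}" and ys: "y = curve L c s"
      using y in_link_setE by blast
    show "a \<in> arc_out L ` removed_points L \<union>
      (\<lambda>c. connected_component_set ?Y (curve L c 0)) ` {1..num_components L}"
    proof (cases "\<exists>u. curve L c u \<in> removed_points L")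
      case True
      then obtain t t' where g: "gap c t t'" "s \<in> {t<..<t'}"
        using gap_around[OF c] y ys by blast
      then have "a = curve L c ` {t<..<t'}"
        using arcs_eqI[OF a gap_arc[OF g(1)] \<open>y \<in> a\<close>] ys by blast
      then have "a = arc_out L (curve L c t)" using arc_out_gap[OF g(1)] by simp
      then show ?thesis using g(1) by (auto simp: gap_def)
    next
      case False
      have "connected (range (curve L c))"
        by (intro connected_continuous_image curve_continuous[OF c]) auto
      moreover have "range (curve L c) \<subseteq> ?Y"
        using False c by (auto simp: link_set_def)
      ultimately have "connected_component ?Y y (curve L c 0)"
        unfolding connected_component_def ys by blast
      then have "a = connected_component_set ?Y (curve L c 0)"
        using connected_component_eq[of "curve L c 0" ?Y y] y(2) by simp
      then show ?thesis using c by blast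
    qed
  qed
  then show ?thesis by (rule finite_subset) (use finite_removed in auto)
qed

section \<open>The successor map on arcs\<close>

lemma followed_by_arc_in:
  assumes j: "j \<in> {1..num_crossings L}"
  shows "followed_by L S (arc_in L (crossing_point L j s)) =
    (\<lambda>b. b = arc_out L (crossing_point L j (if j \<in> S then \<not> s else s)))"
proof -
  have "arc_in L (crossing_point L j s) = arc_in L (crossing_point L j' s') \<longleftrightarrow> j = j' \<and> s = s'"
    if "j' \<in> {1..num_crossings L}" for j' s'
    using inj_on_eq_iff[OF inj_on_arc_in crossing_point_removed[OF j] crossing_point_removed[OF that]]
      crossing_point_eq_iff[OF j that] by simp
  then show ?thesis using j unfolding followed_by_def by (intro ext) auto
qed

lemma next_arc_arc_in:
  assumes "j \<in> {1..num_crossings L}"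
  shows "next_arc L S (arc_in L (crossing_point L j s)) =
    arc_out L (crossing_point L j (if j \<in> S then \<not> s else s))"
  unfolding next_arc_def by (simp add: followed_by_arc_in[OF assms])

lemma next_arc_other: "a \<notin> arc_in L ` removed_points L \<Longrightarrow> next_arc L S a = a"
  unfolding next_arc_def followed_by_def using crossing_point_removed by force

text \<open>On a finite set it is enough to have an injective self-map. Smoothing only permutes the
  removed points before \<open>arc_out\<close> is applied, and the map is the identity on arcs
  without ends.\<close>

lemma next_arc_permutes: "next_arc L S permutes arcs L"
proof (rule bij_imp_permutes)
  let ?f = "next_arc L S" and ?I = "arc_in L ` removed_points L"
  have f_out: "\<exists>p\<in>removed_points L. ?f a = arc_out L p" if "a \<in> ?I" for a
  proof -
    obtain p where p: "p \<in> removed_points L" "a = arc_in L p" using \<open>a \<in> ?I\<close> by blast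
    obtain i s where "i \<in> {1..num_crossings L}" "p = crossing_point L i s"
      by (rule removed_pointsE[OF p(1)])
    then show ?thesis using p(2) next_arc_arc_in crossing_point_removed by blast
  qed
  have f_I: "?f a \<in> ?I" if "a \<in> ?I" for a
    using f_out[OF that] unfolding arc_in_image by blast
  have "?f ` arcs L \<subseteq> arcs L"
  proof (rule image_subsetI)
    fix a assume "a \<in> arcs L"
    then show "?f a \<in> arcs L"
    proof (cases "a \<in> ?I")
      case True
      then obtain p where "p \<in> removed_points L" "?f a = arc_out L p" using f_out by blast
      then show ?thesis by (simp add: arc_out_in_arcs)
    next
      case False
      then show ?thesis using \<open>a \<in> arcs L\<close> by (simp add: next_arc_other)
    qed
  qed
  moreover have "inj_on ?f (arcs L)"
  proof (rule inj_onI)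
    fix a b assume "?f a = ?f b"
    show "a = b"
    proof (cases "a \<in> ?I \<and> b \<in> ?I")
      case True
      then obtain i s j u where ij: "i \<in> {1..num_crossings L}" "j \<in> {1..num_crossings L}"
        "a = arc_in L (crossing_point L i s)" "b = arc_in L (crossing_point L j u)"
        by (elim conjE imageE removed_pointsE) blast
      then have "crossing_point L i (if i \<in> S then \<not> s else s) = crossing_point L j (if j \<in> S then \<not> u else u)"
        using \<open>?f a = ?f b\<close>
        by (intro inj_onD[OF inj_on_arc_out] crossing_point_removed) (simp_all add: next_arc_arc_in)
      then show ?thesis using ij crossing_point_eq_iff by (auto split: if_splits)
    next
      case False
      \<comment> \<open>Arcs with ends go to arcs with ends and the others are fixed, so equal
        images force both arcs to be of the same kind, here fixed ones.\<close>
      have f_I_iff: "?f x \<in> ?I \<longleftrightarrow> x \<in> ?I" for x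
      proof (cases "x \<in> ?I")
        case False
        then show ?thesis by (simp only: next_arc_other[OF False])
      qed (use f_I in blast)
      have "a \<in> ?I \<longleftrightarrow> b \<in> ?I"
        using f_I_iff[of a] f_I_iff[of b] unfolding \<open>?f a = ?f b\<close> by blast
      then have "a \<notin> ?I" "b \<notin> ?I" using False by blast+
      then show ?thesis using \<open>?f a = ?f b\<close> by (metis next_arc_other)
    qed
  qed
  ultimately show "bij_betw ?f (arcs L) (arcs L)"
    unfolding bij_betw_def using endo_inj_surj[OF finite_arcs] by blast
  fix a assume "a \<notin> arcs L"
  then show "?f a = a" using arc_in_in_arcs by (intro next_arc_other) blast
qed

end

section \<open>Exponentials of the crossing operators\<close>

text \<open>The combination \<open>U + \<mu> V\<close> is an eigenvector with eigenvalue
  \<open>\<epsilon> * \<mu>\<close> exactly because \<open>\<mu>\<close> solves the quadratic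
  equation. The starting vector is \<open>c\<close> times one such eigenvector plus \<open>d\<close>
  times the other, so the powers of \<open>D\<close> are geometric in each part and the series
  splits into two exponential series.\<close>

lemma exp_series_eigenvectors:
  fixes U V :: "('a, 'n::finite) matrix_function" and \<beta> \<epsilon> n \<mu> \<nu> :: complex
  assumes D: "\<And>x y. D (\<lambda>h. x * U h + y * V h) = (\<lambda>h. \<epsilon> * y * U h + \<epsilon> * (2 * x + n * y) * V h)"
    and \<mu>: "\<mu>\<^sup>2 = n * \<mu> + 2" and \<nu>: "\<nu>\<^sup>2 = n * \<nu> + 2"
  shows "(\<lambda>r. \<beta> ^ r / fact r * (D ^^ r) (\<lambda>h. (c + d) * U h + (c * \<mu> + d * \<nu>) * V h) h) sums
    (c * exp (\<beta> * \<epsilon> * \<mu>) * (U h + \<mu> * V h) + d * exp (\<beta> * \<epsilon> * \<nu>) * (U h + \<nu> * V h))"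
proof -
  have pow: "(D ^^ r) (\<lambda>h. (c + d) * U h + (c * \<mu> + d * \<nu>) * V h) =
      (\<lambda>h. (c * (\<epsilon> * \<mu>) ^ r + d * (\<epsilon> * \<nu>) ^ r) * U h +
        (c * (\<epsilon> * \<mu>) ^ r * \<mu> + d * (\<epsilon> * \<nu>) ^ r * \<nu>) * V h)" for r
  proof (induction r)
    case (Suc r)
    have step: "2 * (c * a + d * b) + n * (c * a * \<mu> + d * b * \<nu>) = c * a * \<mu>\<^sup>2 + d * b * \<nu>\<^sup>2" for a b
      by (simp add: \<mu> \<nu> algebra_simps)
    show ?case
      unfolding funpow.simps o_apply Suc.IH D step
      by (simp add: fun_eq_iff algebra_simps power2_eq_square)
  qed simp
  have exp: "(\<lambda>r. (\<beta> * \<epsilon> * m) ^ r / fact r) sums exp (\<beta> * \<epsilon> * m)" for m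
    using exp_converges[of "\<beta> * \<epsilon> * m"] by (simp add: scaleR_conv_of_real divide_inverse mult.commute)
  have "(\<lambda>r. (\<beta> * \<epsilon> * \<mu>) ^ r / fact r * (c * (U h + \<mu> * V h)) +
        (\<beta> * \<epsilon> * \<nu>) ^ r / fact r * (d * (U h + \<nu> * V h))) sums
      (exp (\<beta> * \<epsilon> * \<mu>) * (c * (U h + \<mu> * V h)) + exp (\<beta> * \<epsilon> * \<nu>) * (d * (U h + \<nu> * V h)))"
    by (intro sums_add sums_mult2 exp)
  also have "(\<lambda>r. (\<beta> * \<epsilon> * \<mu>) ^ r / fact r * (c * (U h + \<mu> * V h)) +
        (\<beta> * \<epsilon> * \<nu>) ^ r / fact r * (d * (U h + \<nu> * V h))) =
      (\<lambda>r. \<beta> ^ r / fact r * (D ^^ r) (\<lambda>h. (c + d) * U h + (c * \<mu> + d * \<nu>) * V h) h)"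
    unfolding pow by (simp add: fun_eq_iff power_mult_distrib field_simps)
  finally show ?thesis by (simp add: mult_ac)
qed

lemma exp_series_pair:
  fixes U V :: "('a, 'n::finite) matrix_function" and \<beta> \<epsilon> n s :: complex
  assumes D: "\<And>x y. D (\<lambda>h. x * U h + y * V h) = (\<lambda>h. \<epsilon> * y * U h + \<epsilon> * (2 * x + n * y) * V h)"
    and s: "s\<^sup>2 = n\<^sup>2 / 4 + 2" "s \<noteq> 0"
  defines "E \<equiv> exp (\<beta> * \<epsilon> * (n / 2 + s))" and "E' \<equiv> exp (\<beta> * \<epsilon> * (n / 2 - s))"
  shows "(\<lambda>r. \<beta> ^ r / fact r * (D ^^ r) U h) sums
      (((n / 2 + s) * E' - (n / 2 - s) * E) / (2 * s) * U h + (E - E') / s * V h)"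
    and "(\<lambda>r. \<beta> ^ r / fact r * (D ^^ r) V h) sums
      ((E - E') / (2 * s) * U h + ((n / 2 + s) * E - (n / 2 - s) * E') / (2 * s) * V h)"
proof -
  let ?\<mu> = "n / 2 + s" and ?\<nu> = "n / 2 - s"
  have sq: "?\<mu>\<^sup>2 = n * ?\<mu> + 2" "?\<nu>\<^sup>2 = n * ?\<nu> + 2"
    using s(1) by (simp_all add: power2_eq_square field_simps)
  have prod: "?\<mu> * ?\<nu> = - 2"
    using s(1) by (simp add: power2_eq_square field_simps)
  note series = exp_series_eigenvectors[where D = D and U = U and V = V, OF D sq, of \<beta> _ _ h, folded E_def E'_def]
  \<comment> \<open>Coordinates of \<open>U\<close> in the two eigenvectors. The product of the
    roots, which is -2, later simplifies the coefficient of \<open>V\<close>.\<close>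
  have "- ?\<nu> / (2 * s) + ?\<mu> / (2 * s) = 1" "- ?\<nu> / (2 * s) * ?\<mu> + ?\<mu> / (2 * s) * ?\<nu> = 0"
    using s(2) by (simp_all add: field_simps)
  then have "(\<lambda>r. \<beta> ^ r / fact r * (D ^^ r) U h) sums
      (- ?\<nu> / (2 * s) * E * (U h + ?\<mu> * V h) + ?\<mu> / (2 * s) * E' * (U h + ?\<nu> * V h))"
    using series[of "- ?\<nu> / (2 * s)" "?\<mu> / (2 * s)"] by simp
  also have "- ?\<nu> / (2 * s) * E * (U h + ?\<mu> * V h) + ?\<mu> / (2 * s) * E' * (U h + ?\<nu> * V h) =
      (?\<mu> * E' - ?\<nu> * E) / (2 * s) * U h + (?\<mu> * ?\<nu>) * (E' - E) / (2 * s) * V h"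
    by (simp add: add_divide_distrib diff_divide_distrib algebra_simps)
  also have "\<dots> = (?\<mu> * E' - ?\<nu> * E) / (2 * s) * U h + (E - E') / s * V h"
    unfolding prod using s(2) by (simp add: field_simps)
  finally show "(\<lambda>r. \<beta> ^ r / fact r * (D ^^ r) U h) sums
      ((?\<mu> * E' - ?\<nu> * E) / (2 * s) * U h + (E - E') / s * V h)" .
  have "1 / (2 * s) + - 1 / (2 * s) = 0" "1 / (2 * s) * ?\<mu> + - 1 / (2 * s) * ?\<nu> = 1"
    using s(2) by (simp_all add: field_simps)
  then have "(\<lambda>r. \<beta> ^ r / fact r * (D ^^ r) V h) sums
      (1 / (2 * s) * E * (U h + ?\<mu> * V h) + - 1 / (2 * s) * E' * (U h + ?\<nu> * V h))"
    using series[of "1 / (2 * s)" "- 1 / (2 * s)"] by simp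
  also have "1 / (2 * s) * E * (U h + ?\<mu> * V h) + - 1 / (2 * s) * E' * (U h + ?\<nu> * V h) =
      (E - E') / (2 * s) * U h + (?\<mu> * E - ?\<nu> * E') / (2 * s) * V h"
    by (simp add: add_divide_distrib diff_divide_distrib algebra_simps)
  finally show "(\<lambda>r. \<beta> ^ r / fact r * (D ^^ r) V h) sums
      ((E - E') / (2 * s) * U h + (?\<mu> * E - ?\<nu> * E') / (2 * s) * V h)" .
qed

text \<open>Half the difference of the roots of the quadratic equation for the eigenvalues, that is,
  half the square root of \<open>n^2 + 8\<close>, with \<open>n = k\<close>.\<close>

definition root_discriminant :: "nat \<Rightarrow> complex" where
  "root_discriminant k = of_real (sqrt (real k ^ 2 / 4 + 2))"

lemma root_discriminant:
  "(root_discriminant k)\<^sup>2 = (of_nat k)\<^sup>2 / 4 + 2" "root_discriminant k \<noteq> 0"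
proof -
  have pos: "real k ^ 2 / 4 + 2 > 0" by (simp add: add_nonneg_pos)
  then show "root_discriminant k \<noteq> 0" by (simp add: root_discriminant_def)
  have "(root_discriminant k)\<^sup>2 = of_real ((sqrt (real k ^ 2 / 4 + 2))\<^sup>2)"
    unfolding root_discriminant_def of_real_power ..
  also have "\<dots> = of_real (real k ^ 2 / 4 + 2)" using pos by (simp only: real_sqrt_pow2 less_imp_le)
  finally show "(root_discriminant k)\<^sup>2 = (of_nat k)\<^sup>2 / 4 + 2" by simp
qed

section \<open>Action of the crossing operators on Wilson loop functions\<close>

locale positioned_link_basis = positioned_link L
  for L :: link +
  fixes e :: "'b::finite \<Rightarrow> complex^'n::finite^'n"
  assumes e: "complex_basis e"
begin

lemma wilson_state_sum: "(wilson L S :: (arc, 'n) matrix_function) = state_sum (arcs L) (next_arc L S)"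
  unfolding wilson_def[abs_def] prod_orbit_traces[OF next_arc_permutes finite_arcs] ..

lemma wilson_polynomial: "(wilson L S :: (arc, 'n) matrix_function) \<in> polynomial_functions (arcs L)"
  unfolding wilson_state_sum by (rule state_sum_polynomial)

abbreviation contraction_at :: "nat \<Rightarrow> (arc, 'n) matrix_function \<Rightarrow> (arc, 'n) matrix_function" where
  "contraction_at j \<equiv> crossing.contraction (arcs L)
     (arc_in L (crossing_point L j True)) (arc_out L (crossing_point L j True))
     (arc_in L (crossing_point L j False)) (arc_out L (crossing_point L j False)) e"

lemma crossing_at:
  assumes j: "j \<in> {1..num_crossings L}"
  shows "crossing (arcs L) (arc_in L (crossing_point L j True)) (arc_out L (crossing_point L j True))
     (arc_in L (crossing_point L j False)) (arc_out L (crossing_point L j False)) e"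
proof
  show "arc_in L (crossing_point L j True) \<noteq> arc_in L (crossing_point L j False)"
    and "arc_out L (crossing_point L j True) \<noteq> arc_out L (crossing_point L j False)"
    using crossing_points(1)[OF j] crossing_point_removed[OF j]
      inj_onD[OF inj_on_arc_in] inj_onD[OF inj_on_arc_out] by blast+
qed (use finite_arcs arc_in_in_arcs arc_out_in_arcs crossing_point_removed[OF j] e in auto)

lemma signed_crossing_operator_contraction:
  assumes j: "j \<in> {1..num_crossings L}"
  shows "signed_crossing_operator L e \<epsilon> j F = (\<lambda>h. 2 * of_real \<epsilon> * contraction_at j F h)"
  unfolding signed_crossing_operator_def point_derivation_def insertion_def[symmetric]
    crossing.contraction_def[OF crossing_at[OF j]] ..

lemma signed_crossing_operator_sum:
  assumes "j \<in> {1..num_crossings L}" "\<And>x. x \<in> X \<Longrightarrow> F x \<in> polynomial_functions (arcs L)"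
  shows "signed_crossing_operator L e \<epsilon> j (\<lambda>h. \<Sum>x\<in>X. c x * F x h) =
    (\<lambda>h. \<Sum>x\<in>X. c x * signed_crossing_operator L e \<epsilon> j (F x) h)"
  unfolding signed_crossing_operator_contraction[OF assms(1)]
  by (simp add: crossing.contraction_sum[OF crossing_at[OF assms(1)], of X F] assms(2)
      sum_distrib_left mult_ac)

lemma signed_crossing_operator_polynomial:
  assumes "F \<in> polynomial_functions (arcs L)"
  shows "signed_crossing_operator L e \<epsilon> j F \<in> polynomial_functions (arcs L)"
  unfolding signed_crossing_operator_def point_derivation_def insertion_def[symmetric]
  using assms by (intro polynomial_functions_scale polynomial_functions_sum insertion_polynomial)

lemma funpow_polynomial:
  assumes "F \<in> polynomial_functions (arcs L)"
  shows "(signed_crossing_operator L e \<epsilon> j ^^ r) F \<in> polynomial_functions (arcs L)"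
  by (induction r) (simp_all add: assms signed_crossing_operator_polynomial)

lemma funpow_sum:
  assumes "j \<in> {1..num_crossings L}" "\<And>x. x \<in> X \<Longrightarrow> F x \<in> polynomial_functions (arcs L)"
  shows "(signed_crossing_operator L e \<epsilon> j ^^ r) (\<lambda>h. \<Sum>x\<in>X. c x * F x h) =
    (\<lambda>h. \<Sum>x\<in>X. c x * (signed_crossing_operator L e \<epsilon> j ^^ r) (F x) h)"
  by (induction r)
     (simp_all add: signed_crossing_operator_sum[OF assms(1)] funpow_polynomial assms(2))

text \<open>Adding \<open>j\<close> to the smoothed crossings exchanges the successors of the two
  arcs arriving there and changes no other successor, which is the reconnection treated for state
  sums.\<close>

lemma contraction_wilson:
  assumes j: "j \<in> {1..num_crossings L}" and T: "j \<notin> T"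
  shows "contraction_at j (wilson L T) h = wilson L (insert j T) h"
    and "contraction_at j (wilson L (insert j T)) h =
      1/2 * (of_nat CARD('n) * wilson L (insert j T) h + wilson L T h)"
proof -
  let ?p = "\<lambda>s. arc_in L (crossing_point L j s)" and ?q = "\<lambda>s. arc_out L (crossing_point L j s)"
  have turn: "next_arc L T (?p s) = ?q s" "next_arc L (insert j T) (?p s) = ?q (\<not> s)" for s
    using next_arc_arc_in[OF j] T by auto
  have same: "next_arc L (insert j T) a = next_arc L T a" if "a \<noteq> ?p True" "a \<noteq> ?p False" for a
  proof (cases "a \<in> arc_in L ` removed_points L")
    case True
    then obtain i s where "i \<in> {1..num_crossings L}" "a = arc_in L (crossing_point L i s)"
      by (blast elim: removed_pointsE)
    moreover from this have "i \<noteq> j" using that by (cases s) auto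
    ultimately show ?thesis by (simp add: next_arc_arc_in)
  next
    case False
    then show ?thesis by (simp only: next_arc_other[OF False])
  qed
  note contract = crossing.contraction_state_sum[OF crossing_at[OF j] next_arc_permutes]
  show "contraction_at j (wilson L T) h = wilson L (insert j T) h"
    unfolding wilson_state_sum by (rule contract(1)) (auto simp: turn same)
  show "contraction_at j (wilson L (insert j T)) h =
      1/2 * (of_nat CARD('n) * wilson L (insert j T) h + wilson L T h)"
    unfolding wilson_state_sum by (rule contract(2)) (auto simp: turn same)
qed

lemma signed_crossing_operator_pair:
  fixes x y :: complex
  assumes j: "j \<in> {1..num_crossings L}" and T: "j \<notin> T"
  shows "signed_crossing_operator L e \<epsilon> j (\<lambda>h. x * wilson L T h + y * wilson L (insert j T) h) =
    (\<lambda>h. of_real \<epsilon> * y * wilson L T h +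
       of_real \<epsilon> * (2 * x + of_nat CARD('n) * y) * wilson L (insert j T) h)"
proof -
  \<comment> \<open>Linearity is available for sums over index sets, so the pair is written as a sum
    over a set of smoothings; distinctness ensures that this sum has two terms.\<close>
  have "T \<noteq> insert j T" using T by auto
  then show ?thesis
    using signed_crossing_operator_sum[OF j, of "{T, insert j T}" "wilson L" \<epsilon> "\<lambda>S. if S = T then x else y"]
    by (simp add: wilson_polynomial signed_crossing_operator_contraction[OF j] contraction_wilson[OF j T]
        algebra_simps)
qed

lemmas exp_series_wilson =
  exp_series_pair[OF signed_crossing_operator_pair root_discriminant]

text \<open>Symmetric difference with \<open>{j}\<close>, an involution by which sums over
  smoothings can be reindexed.\<close>

definition toggle :: "nat \<Rightarrow> nat set \<Rightarrow> nat set" where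
  "toggle j T = (if j \<in> T then T - {j} else insert j T)"

text \<open>The two cases of the exponential formula in uniform shape. Since the coefficients see
  \<open>T\<close> only through membership of \<open>j\<close>, they cannot notice a smoothing at a
  different crossing.\<close>

lemma exp_series_toggle:
  assumes j: "j \<in> {1..num_crossings L}"
  obtains p q :: "bool \<Rightarrow> complex" where
    "\<And>T h. (\<lambda>r. \<beta> ^ r / fact r * (signed_crossing_operator L e \<epsilon> j ^^ r) (wilson L T) h) sums
      (p (j \<in> T) * wilson L T h + q (j \<in> T) * wilson L (toggle j T) h)"
proof -
  let ?s = "root_discriminant CARD('n)" and ?n = "of_nat CARD('n) :: complex"
  define E E' where "E = exp (\<beta> * of_real \<epsilon> * (?n / 2 + ?s))" and "E' = exp (\<beta> * of_real \<epsilon> * (?n / 2 - ?s))"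
  let ?p = "\<lambda>b. if b then ((?n / 2 + ?s) * E - (?n / 2 - ?s) * E') / (2 * ?s)
      else ((?n / 2 + ?s) * E' - (?n / 2 - ?s) * E) / (2 * ?s)"
    and ?q = "\<lambda>b. if b then (E - E') / (2 * ?s) else (E - E') / ?s"
  have "(\<lambda>r. \<beta> ^ r / fact r * (signed_crossing_operator L e \<epsilon> j ^^ r) (wilson L T) h) sums
      (?p (j \<in> T) * wilson L T h + ?q (j \<in> T) * wilson L (toggle j T) h)" for T h
  proof (cases "j \<in> T")
    case True
    have "insert j (T - {j}) = T" using True by auto
    then show ?thesis
      using exp_series_wilson(2)[OF j, of "T - {j}" \<beta> \<epsilon> h] True
      by (simp add: toggle_def E_def E'_def add.commute)
  next
    case False
    then show ?thesis
      using exp_series_wilson(1)[OF j, of T \<beta> \<epsilon> h] by (simp add: toggle_def E_def E'_def)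
  qed
  then show ?thesis by (rule that)
qed

text \<open>Linearity of the exponential on finite combinations. The assumed convergence of each
  summand allows the finite sum and the series to be interchanged.\<close>

lemma exp_operator_sum:
  assumes j: "j \<in> {1..num_crossings L}"
    and series: "\<And>x h. x \<in> X \<Longrightarrow>
      (\<lambda>r. \<beta> ^ r / fact r * (signed_crossing_operator L e \<epsilon> j ^^ r) (wilson L (g x)) h) sums G x h"
  shows "exp_operator \<beta> (signed_crossing_operator L e \<epsilon> j) (\<lambda>h. \<Sum>x\<in>X. c x * wilson L (g x) h) =
    (\<lambda>h. \<Sum>x\<in>X. c x * G x h)"
proof
  fix h
  have "(\<lambda>r. \<Sum>x\<in>X. c x * (\<beta> ^ r / fact r * (signed_crossing_operator L e \<epsilon> j ^^ r) (wilson L (g x)) h)) sums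
      (\<Sum>x\<in>X. c x * G x h)"
    by (intro sums_sum sums_mult series)
  then show "exp_operator \<beta> (signed_crossing_operator L e \<epsilon> j) (\<lambda>h. \<Sum>x\<in>X. c x * wilson L (g x) h) h =
      (\<Sum>x\<in>X. c x * G x h)"
    unfolding exp_operator_def funpow_sum[OF j wilson_polynomial]
    by (simp add: sum_distrib_left mult.left_commute sums_unique[symmetric])
qed

text \<open>The exponentials at crossings other than \<open>i\<close> act by the same coefficients whether or
  not the crossing \<open>i\<close> is smoothed.\<close>

lemma foldr_exp_expansion:
  assumes S: "S \<subseteq> {1..num_crossings L} - {i}" and "set js \<subseteq> {1..num_crossings L} - {i}"
  obtains c :: "nat set \<Rightarrow> complex" where
    "foldr (\<lambda>j. exp_operator \<beta> (crossing_operator L e j)) js (wilson L S) =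
      (\<lambda>h. \<Sum>T\<in>Pow ({1..num_crossings L} - {i}). c T * wilson L T h)"
    "foldr (\<lambda>j. exp_operator \<beta> (crossing_operator L e j)) js (wilson L (insert i S)) =
      (\<lambda>h. \<Sum>T\<in>Pow ({1..num_crossings L} - {i}). c T * wilson L (insert i T) h)"
proof -
  let ?X = "Pow ({1..num_crossings L} - {i})"
  let ?E = "\<lambda>js. foldr (\<lambda>j. exp_operator \<beta> (crossing_operator L e j)) js"
  have "\<exists>c :: nat set \<Rightarrow> complex.
      ?E js (wilson L S) = (\<lambda>h. \<Sum>T\<in>?X. c T * wilson L T h) \<and>
      ?E js (wilson L (insert i S)) = (\<lambda>h. \<Sum>T\<in>?X. c T * wilson L (insert i T) h)"
    using assms(2)
  proof (induction js)
    case Nil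
    have "(\<Sum>T\<in>?X. (if T = S then 1 else 0) * F T) = F S" for F :: "nat set \<Rightarrow> complex"
    proof -
      have "(\<Sum>T\<in>?X. (if T = S then 1 else 0) * F T) = (\<Sum>T\<in>?X. if T = S then F T else 0)"
        by (intro sum.cong) auto
      then show ?thesis using S by simp
    qed
    then show ?case by (intro exI[of _ "\<lambda>T. if T = S then 1 else 0"]) simp
  next
    case (Cons j js)
    then have j: "j \<in> {1..num_crossings L}" "j \<noteq> i" by auto
    obtain c where c: "?E js (wilson L S) = (\<lambda>h. \<Sum>T\<in>?X. c T * wilson L T h)"
      "?E js (wilson L (insert i S)) = (\<lambda>h. \<Sum>T\<in>?X. c T * wilson L (insert i T) h)"
      using Cons by auto
    obtain p q :: "bool \<Rightarrow> complex" where pq: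
      "\<And>T h. (\<lambda>r. \<beta> ^ r / fact r * (crossing_operator L e j ^^ r) (wilson L T) h) sums
        (p (j \<in> T) * wilson L T h + q (j \<in> T) * wilson L (toggle j T) h)"
      using exp_series_toggle[OF j(1), of \<beta> "crossing_sign L j"] unfolding crossing_operator_def by blast
    \<comment> \<open>After the exponential at \<open>j\<close>, the smoothing \<open>T\<close>
      receives a contribution from \<open>T\<close> itself and one from
      \<open>toggle j T\<close>.\<close>
    define c' where "c' T = c T * p (j \<in> T) + c (toggle j T) * q (j \<in> toggle j T)" for T
    \<comment> \<open>Handles both expansions at once: \<open>g\<close> is the identity for the
      first and \<open>insert i\<close> for the second. The two conditions on \<open>g\<close> hold
      for \<open>insert i\<close> because \<open>j\<close> differs from \<open>i\<close>.\<close>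
    have step: "?E (j # js) (wilson L R) = (\<lambda>h. \<Sum>T\<in>?X. c' T * wilson L (g T) h)"
      if R: "?E js (wilson L R) = (\<lambda>h. \<Sum>T\<in>?X. c T * wilson L (g T) h)"
        and g: "\<And>T. j \<in> g T \<longleftrightarrow> j \<in> T" "\<And>T. toggle j (g T) = g (toggle j T)" for R g
    proof -
      have "?E (j # js) (wilson L R) = (\<lambda>h. \<Sum>T\<in>?X.
          c T * (p (j \<in> g T) * wilson L (g T) h + q (j \<in> g T) * wilson L (toggle j (g T)) h))"
        unfolding foldr.simps o_apply R
        unfolding crossing_operator_def
        by (rule exp_operator_sum[OF j(1)]) (rule pq[unfolded crossing_operator_def])
      also have "\<dots> = (\<lambda>h. (\<Sum>T\<in>?X. c T * p (j \<in> T) * wilson L (g T) h) +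
          (\<Sum>T\<in>?X. c T * q (j \<in> T) * wilson L (g (toggle j T)) h))"
        by (simp add: g sum.distrib distrib_left mult.assoc)
      also have "\<dots> = (\<lambda>h. \<Sum>T\<in>?X. c' T * wilson L (g T) h)"
      proof
        fix h
        have "(\<Sum>T\<in>?X. c T * q (j \<in> T) * wilson L (g (toggle j T)) h) =
            (\<Sum>T\<in>?X. c (toggle j T) * q (j \<in> toggle j T) * wilson L (g T) h)"
          using j by (intro sum.reindex_bij_witness[of _ "toggle j" "toggle j"])
            (auto simp: toggle_def insert_absorb)
        then show "(\<Sum>T\<in>?X. c T * p (j \<in> T) * wilson L (g T) h) +
            (\<Sum>T\<in>?X. c T * q (j \<in> T) * wilson L (g (toggle j T)) h) =
            (\<Sum>T\<in>?X. c' T * wilson L (g T) h)"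
          by (simp add: c'_def sum.distrib distrib_right)
      qed
      finally show ?thesis .
    qed
    have "toggle j (insert i T) = insert i (toggle j T)" for T
      using j(2) by (auto simp: toggle_def)
    then show ?case
      using step[OF c(1)] step[of "insert i S" "insert i", OF c(2)] j(2)
      by (intro exI[of _ c']) simp
  qed
  then show ?thesis using that by blast
qed

text \<open>Every smoothing in the expansion of \<open>Q (W S)\<close> omits \<open>i\<close>, so
  the exponential at \<open>i\<close> acts on each with the same two coefficients. Regrouping gives
  the expansions of the two \<open>Q\<close> terms back, in place of commuting the exponential past
  \<open>Q\<close>.\<close>

lemma exp_signed_crossing_other_crossings:
  fixes \<beta> :: complex and \<epsilon> :: real
  assumes i: "i \<in> {1..num_crossings L}" and S: "S \<subseteq> {1..num_crossings L} - {i}"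
  defines "E \<equiv> exp (\<beta> * of_real \<epsilon> * (of_nat CARD('n) / 2 + root_discriminant CARD('n)))"
    and "E' \<equiv> exp (\<beta> * of_real \<epsilon> * (of_nat CARD('n) / 2 - root_discriminant CARD('n)))"
  shows "exp_operator \<beta> (signed_crossing_operator L e \<epsilon> i) (other_crossings L e \<beta> i (wilson L S)) h =
    ((of_nat CARD('n) / 2 + root_discriminant CARD('n)) * E' - (of_nat CARD('n) / 2 - root_discriminant CARD('n)) * E) /
        (2 * root_discriminant CARD('n)) * other_crossings L e \<beta> i (wilson L S) h +
    (E - E') / root_discriminant CARD('n) * other_crossings L e \<beta> i (wilson L (insert i S)) h"
proof -
  let ?X = "Pow ({1..num_crossings L} - {i})"
  have "set (filter (\<lambda>j. j \<noteq> i) [1..<Suc (num_crossings L)]) \<subseteq> {1..num_crossings L} - {i}"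
    by auto
  then obtain c :: "nat set \<Rightarrow> complex" where c:
    "other_crossings L e \<beta> i (wilson L S) = (\<lambda>h. \<Sum>T\<in>?X. c T * wilson L T h)"
    "other_crossings L e \<beta> i (wilson L (insert i S)) = (\<lambda>h. \<Sum>T\<in>?X. c T * wilson L (insert i T) h)"
    using foldr_exp_expansion[OF S, of _ \<beta>] unfolding other_crossings_def by blast
  define a where "a = ((of_nat CARD('n) / 2 + root_discriminant CARD('n)) * E' -
      (of_nat CARD('n) / 2 - root_discriminant CARD('n)) * E) / (2 * root_discriminant CARD('n))"
  define b where "b = (E - E') / root_discriminant CARD('n)"
  have "(\<lambda>r. \<beta> ^ r / fact r * (signed_crossing_operator L e \<epsilon> i ^^ r) (wilson L T) h) sums
      (a * wilson L T h + b * wilson L (insert i T) h)" if "T \<in> ?X" for T h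
    unfolding a_def b_def E_def E'_def using that by (intro exp_series_wilson(1) i) auto
  then have "exp_operator \<beta> (signed_crossing_operator L e \<epsilon> i) (\<lambda>h. \<Sum>T\<in>?X. c T * wilson L T h) =
      (\<lambda>h. \<Sum>T\<in>?X. c T * (a * wilson L T h + b * wilson L (insert i T) h))"
    by (rule exp_operator_sum[OF i])
  then show ?thesis
    unfolding c a_def[symmetric] b_def[symmetric]
    by (simp add: sum_distrib_left sum.distrib distrib_left mult_ac)
qed

end

section \<open>The skein relation\<close>

theorem mainTheorem3:
  fixes L :: link
    and e :: "'b::finite \<Rightarrow> complex^'n::finite^'n"
    and lam \<beta> n sq :: complex
    and i :: nat and S :: "nat set"
    and Q :: "(arc, 'n) matrix_function \<Rightarrow> (arc, 'n) matrix_function"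
    and W :: "nat set \<Rightarrow> (arc, 'n) matrix_function"
    and over under :: "(arc, 'n) matrix_function"
  defines "n \<equiv> of_nat CARD('n)"
    and "sq \<equiv> of_real (sqrt (real CARD('n) ^ 2 / 4 + 2))"
    and "\<beta> \<equiv> 1 / (2 * lam)"
    and "W \<equiv> wilson L"
    and "Q \<equiv> other_crossings L e \<beta> i"
    and "over \<equiv> exp_operator \<beta> (signed_crossing_operator L e 1 i) (Q (W S))"
    and "under \<equiv> exp_operator \<beta> (signed_crossing_operator L e (-1) i) (Q (W S))"
  assumes "basis_gl e \<or> basis_u e"
    and "lam \<noteq> 0"
    and "general_position L"
    and "i \<in> {1..num_crossings L}"
    and "S \<subseteq> {1..num_crossings L} - {i}"
  shows "(\<forall>h. exp (- \<beta> * n / 2) * over h =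
            (cosh (\<beta> * sq) - n / (2 * sq) * sinh (\<beta> * sq)) * Q (W S) h
            + 2 / sq * sinh (\<beta> * sq) * Q (W (S \<union> {i})) h) \<and>
         (\<forall>h. exp (\<beta> * n / 2) * under h =
            (cosh (\<beta> * sq) + n / (2 * sq) * sinh (\<beta> * sq)) * Q (W S) h
            - 2 / sq * sinh (\<beta> * sq) * Q (W (S \<union> {i})) h) \<and>
         (cosh (\<beta> * sq) \<noteq> 0 \<longrightarrow>
          (\<forall>h. (1 + n / (2 * sq) * tanh (\<beta> * sq)) * exp (- \<beta> * n / 2) * over h
             - (1 - n / (2 * sq) * tanh (\<beta> * sq)) * exp (\<beta> * n / 2) * under h
             = 4 / sq * sinh (\<beta> * sq) * Q (W (S \<union> {i})) h))"
proof -
  interpret positioned_link_basis L e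
    using assms(8,10) complex_basis_gl complex_basis_u by unfold_locales blast+
  have sq: "sq = root_discriminant CARD('n)" by (simp add: sq_def root_discriminant_def)
  have "sq \<noteq> 0" unfolding sq by (rule root_discriminant(2))
  have union: "S \<union> {i} = insert i S" by simp
  note exp_Q = exp_signed_crossing_other_crossings[OF assms(11,12), of \<beta>,
      folded n_def sq Q_def W_def]
  \<comment> \<open>The prefactors remove \<open>n / 2\<close>, the mean of the two eigenvalues up
    to sign, and leave the symmetric exponentials from which \<open>cosh\<close> and
    \<open>sinh\<close> are built.\<close>
  have cancel: "exp (- \<beta> * n / 2) * exp (\<beta> * (n / 2 + sq)) = exp (\<beta> * sq)"
    "exp (- \<beta> * n / 2) * exp (\<beta> * (n / 2 - sq)) = exp (- (\<beta> * sq))"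
    "exp (\<beta> * n / 2) * exp (- \<beta> * (n / 2 + sq)) = exp (- (\<beta> * sq))"
    "exp (\<beta> * n / 2) * exp (- \<beta> * (n / 2 - sq)) = exp (\<beta> * sq)"
    unfolding exp_add[symmetric] by (simp_all add: field_simps)
  have coeff: "((n / 2 + sq) * exp (- z) - (n / 2 - sq) * exp z) / (2 * sq) = cosh z - n / (2 * sq) * sinh z"
    "((n / 2 + sq) * exp z - (n / 2 - sq) * exp (- z)) / (2 * sq) = cosh z + n / (2 * sq) * sinh z"
    "(exp z - exp (- z)) / sq = 2 / sq * sinh z" "(exp (- z) - exp z) / sq = - (2 / sq * sinh z)" for z
    using \<open>sq \<noteq> 0\<close> by (simp_all add: cosh_field_def sinh_field_def field_simps)
  \<comment> \<open>Moves the prefactor onto the two exponentials, where the cancellations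
    apply.\<close>
  have factor: "x * (((n / 2 + sq) * E' - (n / 2 - sq) * E) / (2 * sq) * u + (E - E') / sq * v) =
      ((n / 2 + sq) * (x * E') - (n / 2 - sq) * (x * E)) / (2 * sq) * u + (x * E - x * E') / sq * v"
    for x E E' u v :: complex
    using \<open>sq \<noteq> 0\<close> by (simp add: field_simps)
  have over: "exp (- \<beta> * n / 2) * over h =
      (cosh (\<beta> * sq) - n / (2 * sq) * sinh (\<beta> * sq)) * Q (W S) h
      + 2 / sq * sinh (\<beta> * sq) * Q (W (S \<union> {i})) h" for h
  proof -
    show ?thesis
      using exp_Q[of 1 h] unfolding over_def union
      by (simp only: factor cancel coeff of_real_1 mult_1_right)
  qed
  have under: "exp (\<beta> * n / 2) * under h =
      (cosh (\<beta> * sq) + n / (2 * sq) * sinh (\<beta> * sq)) * Q (W S) h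
      - 2 / sq * sinh (\<beta> * sq) * Q (W (S \<union> {i})) h" for h
  proof -
    have "\<beta> * of_real (- 1) = - \<beta>" by simp
    then show ?thesis
      using exp_Q[of "- 1" h] unfolding under_def union
      by (simp only: factor cancel coeff) simp
  qed
  have skein: "(1 + n / (2 * sq) * tanh (\<beta> * sq)) * exp (- \<beta> * n / 2) * over h
      - (1 - n / (2 * sq) * tanh (\<beta> * sq)) * exp (\<beta> * n / 2) * under h
      = 4 / sq * sinh (\<beta> * sq) * Q (W (S \<union> {i})) h" if "cosh (\<beta> * sq) \<noteq> 0" for h
  proof -
    \<comment> \<open>The factors equal \<open>(c + k s) / c\<close> and
      \<open>(c - k s) / c\<close>; with them both coefficients of \<open>u\<close> become
      \<open>(c^2 - k^2 s^2) / c\<close> and cancel, while the contributions to \<open>v\<close> add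
      up to \<open>2 t s\<close>.\<close>
    have "(1 + k * (s / c)) * ((c - k * s) * u + t * s * v) - (1 - k * (s / c)) * ((c + k * s) * u - t * s * v) =
        2 * t * s * v" if "c \<noteq> 0" for k s c t u v :: complex
      using that by (simp add: field_simps)
    note identity = this[OF that]
    have "(1 + n / (2 * sq) * tanh (\<beta> * sq)) * exp (- \<beta> * n / 2) * over h
        - (1 - n / (2 * sq) * tanh (\<beta> * sq)) * exp (\<beta> * n / 2) * under h =
        2 * (2 / sq) * sinh (\<beta> * sq) * Q (W (S \<union> {i})) h"
      unfolding mult.assoc[of _ "exp _" "over h"] mult.assoc[of _ "exp _" "under h"] over under tanh_def
      by (rule identity)
    then show ?thesis by simp
  qed
  show ?thesis using over under skein by blast
qed

end
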